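(* Let $D$ be a chord diagram, $a$ a chord of $D$, and $b_1,\dots,b_m$ all the chords of $D$ intersecting $a$. Then \[ W(D)=c\,W(D_a)-y\sum_{i}W(D_{a,i})+y\sum_{i<j}\Big(W(D^{+-}_{a,ij})+W(D^{-+}_{a,ij})-W(D^{l}_{a,ij})-W(D^{r}_{a,ij})\Big), \] where $y=-h^2$. Since every diagram on the right has fewer chords than $D$, this together with $W(\emptyset)=1$ determines $W$ on all chord diagrams.
   Context: Let $\mathfrak g=gl(1|1)$ be the Lie superalgebra with homogeneous basis $H,G$ (even) and $Q_+,Q_-$ (odd) (the matrices $H=I$, $G=\mathrm{diag}(0,1)$, $Q_+=E_{21}$, $Q_-=E_{12}$ acting on $\mathbb C^{1|1}$), whose nonzero supercommutators of basis elements are $[G,Q_\pm]=\pm Q_\pm$, $[Q_+,Q_-]=H$ and those obtained from these by super-antisymmetry. Equip $\mathfrak g$ with the even, supersymmetric, invariant, nondegenerate bilinear form with $\langle Q_+,Q_-\rangle=1=-\langle Q_-,Q_+\rangle$, $\langle H,G\rangle=\langle G,H\rangle=1$ and all other pairings of basis elements zero. Write $\{e_i\}$ for this basis and $(C^{ij})$ for the inverse of the Gram matrix $(\langle e_i,e_j\rangle)$, so that the Casimir tensor is $C=\sum_{i,j}C^{ij}e_i\otimes e_j=G\otimes H+H\otimes G+Q_-\otimes Q_+-Q_+\otimes Q_-$. Let $U=U(\mathfrak g)$ be the universal enveloping superalgebra, $h\in U$ the image of $H$, and $c=\sum C^{ij}e_ie_j\in U$. The centre of $U$ is the polynomial algebra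 $\mathbb C[h,c]$. Put $y=-h^2$. A chord diagram of order $n$ is an oriented circle together with $n$ pairwise disjoint unordered pairs of distinct points on it (chords), considered up to orientation-preserving diffeomorphism of the circle. The universal $gl(1|1)$ weight system $W$ is defined as follows: cut the circle at a point that is not an endpoint, number the $2n$ endpoints $1,\dots,2n$ following the orientation, and let the $k$-th chord have endpoints $p_k<q_k$. Then $W(D)=\sum \big(\prod_{k}C^{i_kj_k}\big)\,\epsilon\,x_1x_2\cdots x_{2n}\in U$, summed over all indices $i_1,j_1,\dots,i_n,j_n$, where $x_{p_k}=e_{i_k}$, $x_{q_k}=e_{j_k}$, and $\epsilon=\pm1$ is the Koszul sign (a factor $-1$ for each transposition of two odd elements) of the rearrangement of $e_{i_1}e_{j_1}e_{i_2}e_{j_2}\cdots e_{i_n}e_{j_n}$ into $x_1\cdots x_{2n}$. $W(D)$ is independent of the cut point and lies in $\mathbb C[h,c]$; $W$ of the diagram with no chords is $1$. Notation for the recursion: for a chord $a$ of $D$, the endpoints of $a$ divide the circle into two open arcs, called the left arc and the right arc. A chord $b$ intersects $a$ if its endpoints separate the endpoints of $a$; then $b$ has one endpoint (its left end) on the left arc and one (its right end) on the right arc. With $b_1,\dots,b_m$ the chords intersecting $a$: $D_a=D\setminus\{a\}$, $D_{a,i}=D\setminus\{a,b_i\}$, $D_{a,ij}=D\setminus\{a,b_i,b_j\}$; $D^{+-}_{a,ij}$ (resp. $D^{-+}_{a,ij}$, $D^{l}_{a,ij}$, $D^{r}_{a,ij}$) is $D_{a,ij}$ with one new chord added joining the left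 end of $b_i$ and the right end of $b_j$ (resp. the right end of $b_i$ and the left end of $b_j$; the left ends of $b_i$ and $b_j$; the right ends of $b_i$ and $b_j$). *)

theory Defs
  imports Complex_Main "HOL-Library.FuncSet"
begin

section \<open>The universal enveloping superalgebra U(gl(1|1)) as T(g)/I\<close>

text \<open>Basis indices: 0 = H, 1 = G (even), 2 = Q+, 3 = Q- (odd).
  Elements of the tensor algebra T(g) (noncommutative polynomials) are represented
  as coefficient functions on words over the basis; U = T(g)/I where I is the
  two-sided ideal generated by x y - (-1)^{|x||y|} y x - [x,y] for basis x, y.\<close>

type_synonym nca = "nat list \<Rightarrow> complex"

definition monom_w :: "nat list \<Rightarrow> nca" where
  "monom_w u = (\<lambda>w. if w = u then 1 else 0)"

definition gen :: "nat \<Rightarrow> nca" where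
  "gen i = monom_w [i]"

definition ncmul :: "nca \<Rightarrow> nca \<Rightarrow> nca" where
  "ncmul f g = (\<lambda>w. \<Sum>k\<le>length w. f (take k w) * g (drop k w))"

definition smul :: "complex \<Rightarrow> nca \<Rightarrow> nca" where
  "smul c f = (\<lambda>w. c * f w)"

definition oddb :: "nat \<Rightarrow> bool" where
  "oddb i \<longleftrightarrow> 2 \<le> i"

definition ksign :: "nat \<Rightarrow> nat \<Rightarrow> complex" where
  "ksign a b = (if oddb a \<and> oddb b then -1 else 1)"

text \<open>Supercommutator of basis elements:
  [G,Q+] = Q+, [G,Q-] = -Q-, [Q+,Q-] = H and super-antisymmetry.\<close>
definition bracket :: "nat \<Rightarrow> nat \<Rightarrow> nca" where
  "bracket a b =
     (if a = 1 \<and> b = 2 then gen 2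
      else if a = 2 \<and> b = 1 then smul (-1) (gen 2)
      else if a = 1 \<and> b = 3 then smul (-1) (gen 3)
      else if a = 3 \<and> b = 1 then gen 3
      else if (a = 2 \<and> b = 3) \<or> (a = 3 \<and> b = 2) then gen 0
      else (\<lambda>_. 0))"

definition rel :: "nat \<Rightarrow> nat \<Rightarrow> nca" where
  "rel a b = (\<lambda>w. ncmul (gen a) (gen b) w - ksign a b * ncmul (gen b) (gen a) w
                  - bracket a b w)"

inductive_set Irel :: "nca set" where
  zero: "(\<lambda>_. 0) \<in> Irel"
| gen: "a < 4 \<Longrightarrow> b < 4 \<Longrightarrow> ncmul (ncmul (monom_w u) (rel a b)) (monom_w v) \<in> Irel"
| add: "f \<in> Irel \<Longrightarrow> g \<in> Irel \<Longrightarrow> (\<lambda>w. f w + g w) \<in> Irel"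
| smult: "f \<in> Irel \<Longrightarrow> smul c f \<in> Irel"

definition ueq :: "nca \<Rightarrow> nca \<Rightarrow> bool" where
  "ueq f g \<longleftrightarrow> (\<lambda>w. f w - g w) \<in> Irel"

definition casC :: "nat \<Rightarrow> nat \<Rightarrow> complex" where
  "casC i j = (if (i = 1 \<and> j = 0) \<or> (i = 0 \<and> j = 1) \<or> (i = 3 \<and> j = 2) then 1
               else if i = 2 \<and> j = 3 then -1 else 0)"

definition casimir :: nca where
  "casimir = (\<lambda>w. \<Sum>i<4. \<Sum>j<4. casC i j * ncmul (gen i) (gen j) w)"

definition h_el :: nca where
  "h_el = gen 0"

definition y_el :: nca where
  "y_el = (\<lambda>w. - ncmul h_el h_el w)"

section \<open>Chord diagrams (cut open: chords are pairs p < q of natural positions)\<close>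

definition endpoints :: "(nat \<times> nat) set \<Rightarrow> nat set" where
  "endpoints D = fst ` D \<union> snd ` D"

definition chord_diagram :: "(nat \<times> nat) set \<Rightarrow> bool" where
  "chord_diagram D \<longleftrightarrow> finite D \<and> (\<forall>ch\<in>D. fst ch < snd ch) \<and>
     (\<forall>c1\<in>D. \<forall>c2\<in>D. c1 \<noteq> c2 \<longrightarrow> {fst c1, snd c1} \<inter> {fst c2, snd c2} = {})"

definition chord_of :: "(nat \<times> nat) set \<Rightarrow> nat \<Rightarrow> nat \<times> nat" where
  "chord_of D s = (THE ch. ch \<in> D \<and> (fst ch = s \<or> snd ch = s))"

definition label :: "(nat \<times> nat) set \<Rightarrow> (nat \<times> nat \<Rightarrow> nat \<times> nat) \<Rightarrow> nat \<Rightarrow> nat" where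
  "label D \<sigma> s = (let ch = chord_of D s in if fst ch = s then fst (\<sigma> ch) else snd (\<sigma> ch))"

text \<open>Position of an endpoint in the reference product e_{i1} e_{j1} e_{i2} e_{j2} ...
  (chords numbered by increasing first endpoint).\<close>
definition refkey :: "(nat \<times> nat) set \<Rightarrow> nat \<Rightarrow> nat" where
  "refkey D s = (let ch = chord_of D s in 2 * fst ch + (if fst ch = s then 0 else 1))"

definition koszul :: "(nat \<times> nat) set \<Rightarrow> (nat \<times> nat \<Rightarrow> nat \<times> nat) \<Rightarrow> complex" where
  "koszul D \<sigma> = (-1) ^ card {(s, t). s \<in> endpoints D \<and> t \<in> endpoints D \<and> s < t \<and>
       oddb (label D \<sigma> s) \<and> oddb (label D \<sigma> t) \<and> refkey D t < refkey D s}"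

definition cword :: "(nat \<times> nat) set \<Rightarrow> (nat \<times> nat \<Rightarrow> nat \<times> nat) \<Rightarrow> nat list" where
  "cword D \<sigma> = map (label D \<sigma>) (sorted_list_of_set (endpoints D))"

definition Wt :: "(nat \<times> nat) set \<Rightarrow> nca" where
  "Wt D = (\<lambda>w. \<Sum>\<sigma>\<in>PiE D (\<lambda>_. {0..<4} \<times> {0..<4}).
             (\<Prod>ch\<in>D. casC (fst (\<sigma> ch)) (snd (\<sigma> ch))) * koszul D \<sigma> * monom_w (cword D \<sigma>) w)"

text \<open>Chord b intersects chord a; left arc of a = open interval (fst a, snd a).\<close>
definition crosses :: "nat \<times> nat \<Rightarrow> nat \<times> nat \<Rightarrow> bool" where
  "crosses a b \<longleftrightarrow> b \<noteq> a \<and>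
     ((fst a < fst b \<and> fst b < snd a) \<noteq> (fst a < snd b \<and> snd b < snd a))"

definition lend :: "nat \<times> nat \<Rightarrow> nat \<times> nat \<Rightarrow> nat" where
  "lend a b = (if fst a < fst b \<and> fst b < snd a then fst b else snd b)"

definition rend :: "nat \<times> nat \<Rightarrow> nat \<times> nat \<Rightarrow> nat" where
  "rend a b = (if fst a < fst b \<and> fst b < snd a then snd b else fst b)"

definition mkchord :: "nat \<Rightarrow> nat \<Rightarrow> nat \<times> nat" where
  "mkchord u v = (min u v, max u v)"

end

(* Let the chord a cut out the word X on its left arc.  Since c is central, expanding the Casimir
   operator ad_C = sum C^{ij} ad(e_i) ad(e_j) on X gives  sum C^{ij} e_i X e_j = c X - (1/2) ad_C X,
   with Koszul signs understood.  By the Leibniz rule ad_C acts on single letters, where it only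
   replaces G by -2H, and on pairs of letters, where only the odd part of C survives.
   Supersymmetry of C then makes the two ends of any other chord enter a pair term with opposite
   signs, so that chords with both ends on the left arc drop out (their single terms cancel against
   the pair term of the two ends).  A crossing chord contributes H H = -y, and a pair of crossing
   chords contributes y times the alternating sum of the four diagrams in which one end of each
   chord is replaced by the central letter H and the remaining two ends are joined. *)

theory Submission
  imports Defs
begin

text \<open>The factor 1/2 disappears because ad_C meets each unordered pair of letters twice; a
  single letter G contributes -(1/2)(-2H) = H. The alternating sum of four diagrams has this origin.
  For odd q, letting ad(q) act on one leg of C gives H (x) q - q (x) H up to sign. Multiplying two
  such tensors, one for Q_- and one for Q_+, and antisymmetrising by the odd part of C gives four
  terms, each with H at two points and the odd part of a Casimir tensor at the other two. The even
  parts G (x) H + H (x) G of these four tensors cancel in the alternating sum, so they may be added,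
  and whole chords appear. The obstacle is bookkeeping: Koszul signs see the positions of all
  letters. Hence positions are never renumbered: words are indexed by finite sets of positions, a
  removed endpoint keeps the even central letter H, and chords are summed out one at a time against
  an arbitrary function of the labelling. The left arc is the interval between the two ends of a, so
  it never contains the cut.\<close>

section \<open>The enveloping superalgebra as a ring\<close>

text \<open>The type \<open>nca\<close> also contains infinite formal sums; finite support singles
  out the tensor algebra itself.\<close>

definition fsupp :: "nca \<Rightarrow> bool" where
  "fsupp f \<longleftrightarrow> finite {w. f w \<noteq> 0}"

lemma fsupp_zero [simp]: "fsupp (\<lambda>_. 0)"
  by (simp add: fsupp_def)

lemma fsupp_monom [simp]: "fsupp (monom_w u)"
  by (simp add: fsupp_def monom_w_def)

lemma fsupp_smul [simp]: "fsupp f \<Longrightarrow> fsupp (smul c f)"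
  unfolding fsupp_def smul_def by (erule rev_finite_subset) auto

lemma fsupp_add [simp]: "fsupp f \<Longrightarrow> fsupp g \<Longrightarrow> fsupp (\<lambda>w. f w + g w)"
  unfolding fsupp_def
  by (rule finite_subset[of _ "{w. f w \<noteq> 0} \<union> {w. g w \<noteq> 0}"]) auto

lemma fsupp_uminus [simp]: "fsupp f \<Longrightarrow> fsupp (\<lambda>w. - f w)"
  by (simp add: fsupp_def)

lemma fsupp_diff [simp]: "fsupp f \<Longrightarrow> fsupp g \<Longrightarrow> fsupp (\<lambda>w. f w - g w)"
  using fsupp_add[of f "\<lambda>w. - g w"] by simp

lemma fsupp_sum: "(\<And>i. i \<in> I \<Longrightarrow> fsupp (F i)) \<Longrightarrow> fsupp (\<lambda>w. \<Sum>i\<in>I. F i w)"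
  by (induction I rule: infinite_finite_induct) auto

lemma fsupp_ncmul [simp]:
  assumes "fsupp f" "fsupp g"
  shows "fsupp (ncmul f g)"
proof -
  have "{w. ncmul f g w \<noteq> 0} \<subseteq> (\<lambda>(u, v). u @ v) ` ({w. f w \<noteq> 0} \<times> {w. g w \<noteq> 0})"
  proof
    fix w assume "w \<in> {w. ncmul f g w \<noteq> 0}"
    then obtain k where "f (take k w) * g (drop k w) \<noteq> 0"
      unfolding ncmul_def by (auto elim: sum.not_neutral_contains_not_neutral)
    then show "w \<in> (\<lambda>(u, v). u @ v) ` ({w. f w \<noteq> 0} \<times> {w. g w \<noteq> 0})"
      by (intro image_eqI[of _ _ "(take k w, drop k w)"]) auto
  qed
  then show ?thesis
    by (rule finite_subset[of "{w. ncmul f g w \<noteq> 0}", folded fsupp_def])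
      (use assms in \<open>simp add: fsupp_def\<close>)
qed

lemma fsupp_induct [consumes 1, case_names zero add]:
  assumes "fsupp f"
    and zero: "P (\<lambda>_. 0)"
    and add: "\<And>c u f. P f \<Longrightarrow> P (\<lambda>w. f w + smul c (monom_w u) w)"
  shows "P f"
proof -
  have "P f" if "finite S" "{w. f w \<noteq> 0} \<subseteq> S" for S f
    using that
  proof (induction S arbitrary: f rule: finite_induct)
    case empty
    then have "f = (\<lambda>_. 0)" by auto
    then show ?case using zero by simp
  next
    case (insert u S)
    have "P (f(u := 0))"
      using insert.prems by (intro insert.IH) auto
    from add[OF this, of "f u" u] show ?case
      by (rule back_subst[of P]) (auto simp: smul_def monom_w_def)
  qed
  then show ?thesis using assms(1) unfolding fsupp_def by blast
qed

section \<open>The concatenation algebra and its two-sided ideal of relations\<close>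

lemma ncmul_monom_monom: "ncmul (monom_w u) (monom_w v) = monom_w (u @ v)"
proof
  fix w
  have split: "take k w = u \<and> drop k w = v \<longleftrightarrow> k = length u \<and> w = u @ v" if "k \<le> length w" for k
    using that by (metis append_eq_conv_conj append_take_drop_id length_take min.absorb2)
  have "ncmul (monom_w u) (monom_w v) w
    = (\<Sum>k\<le>length w. if take k w = u \<and> drop k w = v then 1 else 0)"
    unfolding ncmul_def monom_w_def by (rule sum.cong) simp_all
  also have "\<dots> = (\<Sum>k\<le>length w. if k = length u then (if w = u @ v then 1 else 0) else 0)"
    by (rule sum.cong) (simp_all add: split)
  also have "\<dots> = monom_w (u @ v) w"
    by (simp add: monom_w_def sum.delta)
  finally show "ncmul (monom_w u) (monom_w v) w = monom_w (u @ v) w" .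
qed

lemma ncmul_add_left: "ncmul (\<lambda>w. f w + g w) h = (\<lambda>w. ncmul f h w + ncmul g h w)"
  by (simp add: ncmul_def sum.distrib distrib_right)

lemma ncmul_add_right: "ncmul h (\<lambda>w. f w + g w) = (\<lambda>w. ncmul h f w + ncmul h g w)"
  by (simp add: ncmul_def sum.distrib distrib_left)

lemma ncmul_diff_left: "ncmul (\<lambda>w. f w - g w) h = (\<lambda>w. ncmul f h w - ncmul g h w)"
  by (simp add: ncmul_def sum_subtractf left_diff_distrib)

lemma ncmul_diff_right: "ncmul h (\<lambda>w. f w - g w) = (\<lambda>w. ncmul h f w - ncmul h g w)"
  by (simp add: ncmul_def sum_subtractf right_diff_distrib)

lemma ncmul_zero_left [simp]: "ncmul (\<lambda>_. 0) f = (\<lambda>_. 0)"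
  by (simp add: ncmul_def)

lemma ncmul_zero_right [simp]: "ncmul f (\<lambda>_. 0) = (\<lambda>_. 0)"
  by (simp add: ncmul_def)

lemma ncmul_smul_left: "ncmul (smul c f) g = smul c (ncmul f g)"
  by (simp add: ncmul_def smul_def sum_distrib_left mult.assoc)

lemma ncmul_smul_right: "ncmul f (smul c g) = smul c (ncmul f g)"
  by (simp add: ncmul_def smul_def sum_distrib_left mult.left_commute)

lemma ncmul_one_left: "ncmul (monom_w []) f = f"
proof
  fix w
  have "ncmul (monom_w []) f w = (\<Sum>k\<le>length w. if k = 0 then f w else 0)"
    unfolding ncmul_def monom_w_def by (intro sum.cong) auto
  then show "ncmul (monom_w []) f w = f w" by simp
qed

lemma ncmul_one_right: "ncmul f (monom_w []) = f"
proof
  fix w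
  have "ncmul f (monom_w []) w = (\<Sum>k\<le>length w. if k = length w then f w else 0)"
    unfolding ncmul_def monom_w_def by (intro sum.cong) auto
  then show "ncmul f (monom_w []) w = f w" by simp
qed

text \<open>Both sides sum over the ways to cut \<open>w\<close> into three consecutive factors; the
  bijection trades the two cut positions for the first cut and the length of the middle
  factor.\<close>

lemma ncmul_assoc: "ncmul (ncmul f g) h = ncmul f (ncmul g h)"
proof
  fix w :: "nat list"
  let ?n = "length w"
  have "ncmul (ncmul f g) h w
    = (\<Sum>k\<le>?n. \<Sum>j\<le>k. f (take j w) * g (drop j (take k w)) * h (drop k w))"
    unfolding ncmul_def
    by (intro sum.cong refl) (auto simp: sum_distrib_right min_def intro!: sum.cong)
  also have "\<dots> = (\<Sum>(k, j)\<in>(SIGMA k:{..?n}. {..k}). f (take j w) * g (drop j (take k w)) * h (drop k w))"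
    by (rule sum.Sigma) auto
  also have "\<dots> = (\<Sum>(j, i)\<in>(SIGMA j:{..?n}. {..?n - j}).
      f (take j w) * (g (take i (drop j w)) * h (drop (i + j) w)))"
    by (rule sum.reindex_bij_witness[of _ "\<lambda>(j, i). (i + j, j)" "\<lambda>(k, j). (j, k - j)"])
       (auto simp: drop_take mult.assoc)
  also have "\<dots> = (\<Sum>j\<le>?n. \<Sum>i\<le>?n - j. f (take j w) * (g (take i (drop j w)) * h (drop (i + j) w)))"
    by (rule sum.Sigma[symmetric]) auto
  also have "\<dots> = ncmul f (ncmul g h) w"
    unfolding ncmul_def by (intro sum.cong refl) (auto simp: sum_distrib_left)
  finally show "ncmul (ncmul f g) h w = ncmul f (ncmul g h) w" .
qed

text \<open>The generators of \<open>Irel\<close> already carry a word on either side, so a further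
  word only lengthens \<open>v\<close>; finite support reduces a general factor to words.\<close>

lemma Irel_ncmul_right: "fsupp g \<Longrightarrow> f \<in> Irel \<Longrightarrow> ncmul f g \<in> Irel"
proof (induction arbitrary: f rule: fsupp_induct)
  case (add c v g)
  have "ncmul f (monom_w v) \<in> Irel"
    using \<open>f \<in> Irel\<close>
  proof induction
    case (gen a b u v')
    have "ncmul (ncmul (ncmul (monom_w u) (rel a b)) (monom_w v')) (monom_w v)
      = ncmul (ncmul (monom_w u) (rel a b)) (monom_w (v' @ v))"
      by (simp add: ncmul_assoc ncmul_monom_monom)
    then show ?case using gen Irel.gen by simp
  qed (auto simp: ncmul_add_left ncmul_smul_left intro: Irel.intros)
  then show ?case
    using add by (auto simp: ncmul_add_right ncmul_smul_right intro!: Irel.add Irel.smult)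
qed (simp add: Irel.zero)

lemma Irel_ncmul_left: "fsupp g \<Longrightarrow> f \<in> Irel \<Longrightarrow> ncmul g f \<in> Irel"
proof (induction arbitrary: f rule: fsupp_induct)
  case (add c u g)
  have "ncmul (monom_w u) f \<in> Irel"
    using \<open>f \<in> Irel\<close>
  proof induction
    case (gen a b u' v)
    have "ncmul (monom_w u) (ncmul (ncmul (monom_w u') (rel a b)) (monom_w v))
      = ncmul (ncmul (monom_w (u @ u')) (rel a b)) (monom_w v)"
      by (simp add: ncmul_assoc flip: ncmul_monom_monom)
    then show ?case using gen Irel.gen by simp
  qed (auto simp: ncmul_add_right ncmul_smul_right intro: Irel.intros)
  then show ?case
    using add by (auto simp: ncmul_add_left ncmul_smul_left intro!: Irel.add Irel.smult)
qed (simp add: Irel.zero)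

lemma Irel_uminus: "f \<in> Irel \<Longrightarrow> (\<lambda>w. - f w) \<in> Irel"
  using Irel.smult[of f "-1"] by (simp add: smul_def)

lemma rel_Nil: "rel a b [] = 0"
  by (simp add: rel_def ncmul_def gen_def monom_w_def bracket_def smul_def)

text \<open>No relation has a constant term, so the coefficient of the empty word (the counit) is
  well defined on the quotient. This separates 0 from 1 there.\<close>

lemma Irel_Nil: "f \<in> Irel \<Longrightarrow> f [] = 0"
  by (induction rule: Irel.induct) (auto simp: ncmul_def smul_def rel_Nil)

section \<open>Congruence modulo the ideal and the quotient ring\<close>

lemma ueq_refl [simp]: "ueq f f"
  by (simp add: ueq_def Irel.zero)

lemma ueq_sym: "ueq f g \<Longrightarrow> ueq g f"
  unfolding ueq_def by (drule Irel_uminus) simp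

lemma ueq_trans: "ueq f g \<Longrightarrow> ueq g h \<Longrightarrow> ueq f h"
  unfolding ueq_def by (drule (1) Irel.add) simp

lemma ueq_add: "ueq f f' \<Longrightarrow> ueq g g' \<Longrightarrow> ueq (\<lambda>w. f w + g w) (\<lambda>w. f' w + g' w)"
  unfolding ueq_def by (drule (1) Irel.add) (simp add: algebra_simps)

lemma ueq_uminus: "ueq f f' \<Longrightarrow> ueq (\<lambda>w. - f w) (\<lambda>w. - f' w)"
  unfolding ueq_def by (drule Irel_uminus) (simp add: algebra_simps)

lemma ueq_diff: "ueq f f' \<Longrightarrow> ueq g g' \<Longrightarrow> ueq (\<lambda>w. f w - g w) (\<lambda>w. f' w - g' w)"
  using ueq_add[OF _ ueq_uminus] by simp

lemma ueq_ncmul: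
  assumes "fsupp f'" "fsupp g" "ueq f f'" "ueq g g'"
  shows "ueq (ncmul f g) (ncmul f' g')"
proof (rule ueq_trans)
  show "ueq (ncmul f g) (ncmul f' g)"
    using assms Irel_ncmul_right[of g "\<lambda>w. f w - f' w"] by (simp add: ueq_def ncmul_diff_left)
  show "ueq (ncmul f' g) (ncmul f' g')"
    using assms Irel_ncmul_left[of f' "\<lambda>w. g w - g' w"] by (simp add: ueq_def ncmul_diff_right)
qed

text \<open>The relation is partial because \<^const>\<open>Irel\<close> only contains finite combinations of words, so it is
  an ideal in the finitely supported functions but not in all functions.\<close>
quotient_type ugl = nca / partial: "\<lambda>f g. fsupp f \<and> fsupp g \<and> ueq f g"
  by (rule part_equivpI) (auto simp: symp_def transp_def intro: ueq_sym ueq_trans exI[of _ "\<lambda>_. 0"])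

instantiation ugl :: ring_1
begin

lift_definition zero_ugl :: ugl is "\<lambda>_. 0" by simp
lift_definition one_ugl :: ugl is "monom_w []" by simp
lift_definition plus_ugl :: "ugl \<Rightarrow> ugl \<Rightarrow> ugl" is "\<lambda>f g w. f w + g w"
  by (simp add: ueq_add)
lift_definition minus_ugl :: "ugl \<Rightarrow> ugl \<Rightarrow> ugl" is "\<lambda>f g w. f w - g w"
  by (simp add: ueq_diff)
lift_definition uminus_ugl :: "ugl \<Rightarrow> ugl" is "\<lambda>f w. - f w"
  by (simp add: ueq_uminus)
lift_definition times_ugl :: "ugl \<Rightarrow> ugl \<Rightarrow> ugl" is ncmul
  by (simp add: ueq_ncmul)

instance
proof
  show "(0::ugl) \<noteq> 1"
  proof
    assume "(0::ugl) = 1"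
    then have "ueq (\<lambda>_. 0) (monom_w [])" by transfer simp
    then show False unfolding ueq_def by (drule_tac Irel_Nil) (simp add: monom_w_def)
  qed
qed (transfer, simp add: ncmul_assoc ncmul_one_left ncmul_one_right ncmul_add_left ncmul_add_right
        algebra_simps)+

end

section \<open>Scalars and words in the quotient ring\<close>

lift_definition cst :: "complex \<Rightarrow> ugl" is "\<lambda>c. smul c (monom_w [])" by simp
lift_definition word :: "nat list \<Rightarrow> ugl" is monom_w by simp

abbreviation gn :: "nat \<Rightarrow> ugl" where "gn i \<equiv> word [i]"

lemma smul_algebra:
  "smul 0 f = (\<lambda>_. 0)" "smul 1 f = f" "smul (- c) f = (\<lambda>w. - smul c f w)"
  "smul (c + d) f = (\<lambda>w. smul c f w + smul d f w)" "smul (c * d) f = smul c (smul d f)"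
  by (simp_all add: smul_def distrib_right mult.assoc)

lemma cst_simps [simp]:
  "cst 0 = 0" "cst 1 = 1" "cst (- c) = - cst c" "cst (c + d) = cst c + cst d"
  "cst (c * d) = cst c * cst d"
  subgoal by transfer (simp add: smul_algebra)
  subgoal by transfer (simp add: smul_algebra)
  subgoal by transfer (simp add: smul_algebra)
  subgoal by transfer (simp add: smul_algebra)
  subgoal by transfer (simp add: smul_algebra ncmul_smul_left ncmul_one_left)
  done

lemma cst_commute: "x * cst c = cst c * x"
  by transfer (simp add: ncmul_smul_left ncmul_smul_right ncmul_one_left ncmul_one_right)

lemma word_Nil [simp]: "word [] = 1"
  by transfer simp

lemma word_append: "word (u @ v) = word u * word v"
  by transfer (simp add: ncmul_monom_monom)

lemma word_Cons: "word (x # u) = gn x * word u"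
  using word_append[of "[x]" u] by simp

lemma abs_ugl_zero: "abs_ugl (\<lambda>_. 0) = 0"
  by (simp add: zero_ugl_def)
lemma abs_ugl_add: "fsupp f \<Longrightarrow> fsupp g \<Longrightarrow> abs_ugl (\<lambda>w. f w + g w) = abs_ugl f + abs_ugl g"
  by (simp add: plus_ugl.abs_eq)
lemma abs_ugl_diff: "fsupp f \<Longrightarrow> fsupp g \<Longrightarrow> abs_ugl (\<lambda>w. f w - g w) = abs_ugl f - abs_ugl g"
  by (simp add: minus_ugl.abs_eq)
lemma abs_ugl_uminus: "fsupp f \<Longrightarrow> abs_ugl (\<lambda>w. - f w) = - abs_ugl f"
  by (simp add: uminus_ugl.abs_eq)
lemma abs_ugl_ncmul: "fsupp f \<Longrightarrow> fsupp g \<Longrightarrow> abs_ugl (ncmul f g) = abs_ugl f * abs_ugl g"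
  by (simp add: times_ugl.abs_eq)
lemma abs_ugl_monom: "abs_ugl (monom_w u) = word u"
  by (simp add: word_def)
lemma abs_ugl_smul: "fsupp f \<Longrightarrow> abs_ugl (smul c f) = cst c * abs_ugl f"
  using abs_ugl_ncmul[of "smul c (monom_w [])" f]
  by (simp only: cst.abs_eq ncmul_smul_left ncmul_one_left fsupp_smul fsupp_monom)
lemma abs_ugl_sum: "(\<And>i. i \<in> I \<Longrightarrow> fsupp (F i)) \<Longrightarrow> abs_ugl (\<lambda>w. \<Sum>i\<in>I. F i w) = (\<Sum>i\<in>I. abs_ugl (F i))"
  by (induction I rule: infinite_finite_induct) (auto simp: abs_ugl_zero abs_ugl_add fsupp_sum)

lemma ueq_iff_abs: "fsupp f \<Longrightarrow> fsupp g \<Longrightarrow> ueq f g \<longleftrightarrow> abs_ugl f = abs_ugl g"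
  using Quotient_rel[OF Quotient_ugl, of f g] by auto

section \<open>Defining relations, PBW rewriting and centrality of the Casimir element\<close>

lemma gn_relation:
  assumes "a < 4" "b < 4"
  shows "gn a * gn b = cst (ksign a b) * (gn b * gn a) + abs_ugl (bracket a b)"
proof -
  have "rel a b \<in> Irel"
    using Irel.gen[OF assms, of "[]" "[]"] by (simp add: ncmul_one_left ncmul_one_right)
  then have "ueq (rel a b) (\<lambda>_. 0)" by (simp add: ueq_def)
  moreover have fs: "fsupp (bracket a b)" "fsupp (gen a)" "fsupp (gen b)"
    by (auto simp: bracket_def gen_def)
  moreover have r: "rel a b = (\<lambda>w. ncmul (gen a) (gen b) w - smul (ksign a b) (ncmul (gen b) (gen a)) w - bracket a b w)"
    by (simp add: rel_def smul_def)
  ultimately have "abs_ugl (rel a b) = 0"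
    by (subst (asm) ueq_iff_abs) (simp_all add: abs_ugl_zero)
  then have "gn a * gn b - cst (ksign a b) * (gn b * gn a) - abs_ugl (bracket a b) = 0"
    using fs by (simp add: r abs_ugl_diff abs_ugl_smul abs_ugl_ncmul gen_def abs_ugl_monom)
  then show ?thesis by (simp add: algebra_simps)
qed

lemma gl11_relations:
  "gn (Suc 0) * gn 0 = gn 0 * gn (Suc 0)" "gn 2 * gn 0 = gn 0 * gn 2" "gn 3 * gn 0 = gn 0 * gn 3"
  "gn 2 * gn (Suc 0) = gn (Suc 0) * gn 2 - gn 2" "gn 3 * gn (Suc 0) = gn (Suc 0) * gn 3 + gn 3"
  "gn 3 * gn 2 = gn 0 - gn 2 * gn 3"
  subgoal using gn_relation[of 1 0] by (simp add: bracket_def ksign_def oddb_def abs_ugl_zero)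
  subgoal using gn_relation[of 2 0] by (simp add: bracket_def ksign_def oddb_def abs_ugl_zero)
  subgoal using gn_relation[of 3 0] by (simp add: bracket_def ksign_def oddb_def abs_ugl_zero)
  subgoal using gn_relation[of 2 1]
    by (simp add: bracket_def ksign_def oddb_def gen_def abs_ugl_smul abs_ugl_monom)
  subgoal using gn_relation[of 3 1]
    by (simp add: bracket_def ksign_def oddb_def gen_def abs_ugl_monom)
  subgoal using gn_relation[of 3 2]
    by (simp add: bracket_def ksign_def oddb_def gen_def abs_ugl_monom)
  done

text \<open>Characteristic 0 enters through the scalar \<open>cst (1/2)\<close>. The relation [Q,Q]
  = 0 only says QQ = -QQ for odd Q; this lemma turns it into QQ = 0.\<close>

lemma eq_uminus_ugl_iff: "z = - z \<longleftrightarrow> z = 0" for z :: ugl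
proof
  assume "z = - z"
  then have "z + z = 0" by (metis add.right_inverse)
  then have "cst (1/2) * (z + z) = 0" by simp
  then have "cst (1/2 + 1/2) * z = 0"
    by (simp only: cst_simps distrib_left distrib_right)
  then show "z = 0" by simp
qed simp

lemma gn_odd_square: "gn 2 * gn 2 = 0" "gn 3 * gn 3 = 0"
  using gn_relation[of 2 2] gn_relation[of 3 3]
  by (simp_all add: bracket_def ksign_def oddb_def abs_ugl_zero eq_uminus_ugl_iff)

text \<open>A rewrite system towards the PBW order H, G, Q_+, Q_-. Each rule is repeated with a tail
  \<open>z\<close> so that it also applies inside right-nested products.\<close>

lemma gl11_PBW:
  "gn (Suc 0) * gn 0 = gn 0 * gn (Suc 0)" "gn 2 * gn 0 = gn 0 * gn 2" "gn 3 * gn 0 = gn 0 * gn 3"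
  "gn 2 * gn (Suc 0) = gn (Suc 0) * gn 2 - gn 2" "gn 3 * gn (Suc 0) = gn (Suc 0) * gn 3 + gn 3"
  "gn 3 * gn 2 = gn 0 - gn 2 * gn 3" "gn 2 * gn 2 = 0" "gn 3 * gn 3 = 0"
  "gn (Suc 0) * (gn 0 * z) = gn 0 * (gn (Suc 0) * z)"
  "gn 2 * (gn 0 * z) = gn 0 * (gn 2 * z)"
  "gn 3 * (gn 0 * z) = gn 0 * (gn 3 * z)"
  "gn 2 * (gn (Suc 0) * z) = gn (Suc 0) * (gn 2 * z) - gn 2 * z"
  "gn 3 * (gn (Suc 0) * z) = gn (Suc 0) * (gn 3 * z) + gn 3 * z"
  "gn 3 * (gn 2 * z) = gn 0 * z - gn 2 * (gn 3 * z)" "gn 2 * (gn 2 * z) = 0" "gn 3 * (gn 3 * z) = 0"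
  using gl11_relations gn_odd_square
  by (simp_all flip: mult.assoc) (simp_all add: left_diff_distrib distrib_right mult.assoc)

lemma cst_left_commute: "cst c * (cst d * z) = cst d * (cst c * z)"
  by (simp only: cst_commute[of "cst c" d] flip: mult.assoc)

lemma word_cst: "word u * cst c = cst c * word u" "word u * (cst c * z) = cst c * (word u * z)"
  by (simp_all only: cst_commute[of "word u" c] flip: mult.assoc)

lemmas cst_normalize = cst_left_commute word_cst mult.assoc

definition cas :: ugl where
  "cas = gn 1 * gn 0 + gn 0 * gn 1 + gn 3 * gn 2 - gn 2 * gn 3"

lemma less_4_cases: "(i::nat) < 4 \<Longrightarrow> (i = 0 \<Longrightarrow> P) \<Longrightarrow> (i = Suc 0 \<Longrightarrow> P) \<Longrightarrow> (i = 2 \<Longrightarrow> P) \<Longrightarrow> (i = 3 \<Longrightarrow> P) \<Longrightarrow> P"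
  by linarith

text \<open>The bound matters: letters from 4 on satisfy no relations in \<open>ugl\<close>. For the
  four generators both sides have the same PBW normal form.\<close>

lemma cas_commute: "i < 4 \<Longrightarrow> cas * gn i = gn i * cas"
  by (erule less_4_cases; simp add: cas_def distrib_left distrib_right left_diff_distrib right_diff_distrib
    mult.assoc gl11_PBW)

section \<open>A Casimir tensor surrounding a word\<close>

text \<open>The Koszul sign of moving an odd element past the letter \<open>i\<close>.\<close>

definition esg :: "nat \<Rightarrow> complex" where
  "esg i = (if oddb i then -1 else 1)"

text \<open>For an odd generator \<open>q\<close>, the supercommutator \<open>[q, i]\<close> is \<open>adc q i\<close> times the generator
  \<open>adl q i\<close>.\<close>
definition adc :: "nat \<Rightarrow> nat \<Rightarrow> complex" where
  "adc q i = (if q = 2 then (if i = 1 then -1 else if i = 3 then 1 else 0)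
              else (if i = 1 \<or> i = 2 then 1 else 0))"

definition adl :: "nat \<Rightarrow> nat \<Rightarrow> nat" where
  "adl q i = (if i = 1 then q else 0)"

definition psg :: "(nat \<Rightarrow> nat) \<Rightarrow> nat set \<Rightarrow> complex" where
  "psg l X = (\<Prod>s\<in>X. esg (l s))"

text \<open>Indexing letters by a finite set of positions, gaps allowed, lets chords be deleted or
  reconnected without renumbering the remaining endpoints.\<close>

definition wd :: "(nat \<Rightarrow> nat) \<Rightarrow> nat set \<Rightarrow> ugl" where
  "wd l X = word (map l (sorted_list_of_set X))"

lemma wd_empty [simp]: "wd l {} = 1"
  by (simp add: wd_def)

lemma wd_insert_min:
  assumes "finite X" "\<forall>s\<in>X. m < s"
  shows "wd l (insert m X) = gn (l m) * wd l X"
proof -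
  have "sorted_list_of_set (insert m X) = m # sorted_list_of_set X"
    using assms by (intro sorted_list_of_set.sorted_key_list_of_set_unique[THEN iffD1])
      (auto simp: sorted_list_of_set.sorted_key_list_of_set_insert_remove intro: less_imp_le)
  then show ?thesis unfolding wd_def by (simp only: list.map word_Cons[of "l m" "map l _"])
qed

lemma wd_cong: "(\<And>s. s \<in> X \<Longrightarrow> l s = l' s) \<Longrightarrow> wd l X = wd l' X"
  unfolding wd_def by (cases "finite X") (auto intro!: arg_cong[of _ _ word])

lemma psg_cases: "psg l X = 1 \<or> psg l X = -1"
  unfolding psg_def by (induction X rule: infinite_finite_induct) (auto simp: esg_def)

lemma gn0_wd:
  assumes "finite X" "\<forall>s. l s < 4"
  shows "wd l X * gn 0 = gn 0 * wd l X"
  using assms(1)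
proof (induction rule: finite_linorder_min_induct)
  case (insert m X)
  have "gn (l m) * gn 0 = gn 0 * gn (l m)"
    by (rule less_4_cases[OF assms(2)[rule_format, of m]]) (simp_all add: gl11_PBW)
  then show ?case
    using insert by (simp add: wd_insert_min mult.assoc) (simp flip: mult.assoc)
qed simp

lemma cas_wd:
  assumes "finite X" "\<forall>s. l s < 4"
  shows "wd l X * cas = cas * wd l X"
  using assms(1)
proof (induction rule: finite_linorder_min_induct)
  case (insert m X)
  then show ?case
    using assms(2) by (simp add: wd_insert_min mult.assoc) (simp add: cas_commute flip: mult.assoc)
qed simp

text \<open>The supercommutator of the odd generator \<open>q\<close> with a word, expanded by the
  Leibniz rule: acting on the letter at \<open>t\<close> costs the sign of carrying \<open>q\<close>
  past the letters before \<open>t\<close>.\<close>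

definition adw :: "nat \<Rightarrow> (nat \<Rightarrow> nat) \<Rightarrow> nat set \<Rightarrow> ugl" where
  "adw q l X = (\<Sum>t\<in>X. cst (psg l {s\<in>X. s < t} * adc q (l t)) * wd (l(t := adl q (l t))) X)"

lemma adw_insert_min:
  assumes "finite X" "\<forall>s\<in>X. m < s"
  shows "adw q l (insert m X) = cst (adc q (l m)) * gn (adl q (l m)) * wd l X
           + cst (esg (l m)) * gn (l m) * adw q l X"
proof -
  have m: "m \<notin> X" using assms by auto
  have "{s \<in> insert m X. s < m} = {}" using assms by auto
  then have 1: "psg l {s \<in> insert m X. s < m} = 1" by (simp only: psg_def prod.empty)
  have 2: "psg l {s \<in> insert m X. s < t} = esg (l m) * psg l {s\<in>X. s < t}" if "t \<in> X" for t
  proof -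
    have "{s \<in> insert m X. s < t} = insert m {s \<in> X. s < t}" using that assms by auto
    then show ?thesis using m assms(1) by (simp add: psg_def)
  qed
  have 3: "wd (l(t := k)) (insert m X) = gn (l m) * wd (l(t := k)) X" if "t \<in> X" for t k
    using that m assms by (subst wd_insert_min) auto
  have 4: "wd (l(m := k)) (insert m X) = gn k * wd l X" for k
    using m assms by (subst wd_insert_min) (auto intro!: arg_cong2[of _ _ _ _ times] wd_cong)
  show ?thesis
    unfolding adw_def sum.insert[OF assms(1) m] 1 4 sum_distrib_left
  proof ( intro arg_cong2[of _ _ _ _ plus] sum.cong refl)
    fix t assume "t \<in> X"
    then show "cst (psg l {s \<in> insert m X. s < t} * adc q (l t)) * wd (l(t := adl q (l t))) (insert m X)
      = cst (esg (l m)) * gn (l m) * (cst (psg l {s \<in> X. s < t} * adc q (l t)) * wd (l(t := adl q (l t))) X)"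
      by (simp only: 2 3) (simp add: cst_normalize)
  qed (simp add: mult.assoc)
qed

text \<open>This is [q, X] = q X - (-1)^|X| X q, solved for the last term; it carries an odd
  generator from the right end of a word to the left end. The induction is the Leibniz rule for the
  first letter.\<close>

lemma wd_odd_gn:
  assumes "finite X" "\<forall>s. l s < 4" "q = 2 \<or> q = 3"
  shows "cst (psg l X) * wd l X * gn q = gn q * wd l X - adw q l X"
  using assms(1)
proof (induction rule: finite_linorder_min_induct)
  case empty
  then show ?case by (simp add: psg_def adw_def)
next
  case (insert m X)
  have m: "m \<notin> X" using insert by auto
  have *: "cst (esg (l m)) * gn (l m) * gn q = gn q * gn (l m) - cst (adc q (l m)) * gn (adl q (l m))"
    using assms(3) assms(2)[rule_format, of m]
    by (auto elim!: less_4_cases simp: esg_def adc_def adl_def oddb_def gl11_PBW)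
  have p: "psg l (insert m X) = esg (l m) * psg l X" using m insert.hyps by (simp add: psg_def)
  have "cst (psg l (insert m X)) * wd l (insert m X) * gn q
      = cst (esg (l m)) * gn (l m) * (cst (psg l X) * wd l X * gn q)"
    using insert.hyps m by (simp add: p wd_insert_min cst_normalize)
  also have "\<dots> = (cst (esg (l m)) * gn (l m) * gn q) * wd l X - cst (esg (l m)) * gn (l m) * adw q l X"
    unfolding insert.IH by (simp only: right_diff_distrib mult.assoc)
  also have "\<dots> = gn q * wd l (insert m X) - adw q l (insert m X)"
    using insert.hyps by (simp add: * adw_insert_min wd_insert_min left_diff_distrib right_diff_distrib diff_diff_eq flip: mult.assoc)
  finally show ?case .
qed

text \<open>The sum of C^ij e_i X e_j for the word X. The odd terms get the Koszul sign of moving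
  the second leg of C across X to its right end.\<close>

definition sandwich :: "(nat \<Rightarrow> nat) \<Rightarrow> nat set \<Rightarrow> ugl" where
  "sandwich l X = gn 1 * wd l X * gn 0 + gn 0 * wd l X * gn 1
     + cst (psg l X) * (gn 3 * wd l X * gn 2 - gn 2 * wd l X * gn 3)"

text \<open>The odd part Q_- (x) Q_+ - Q_+ (x) Q_- of C, its legs acting on the letters at
  \<open>s\<close> and \<open>t\<close>. The even part contributes nothing to pairs: one of its legs
  is H, which acts by zero.\<close>

definition casm :: "(nat \<Rightarrow> nat) \<Rightarrow> nat \<Rightarrow> nat \<Rightarrow> nat set \<Rightarrow> ugl" where
  "casm l s t X =
     cst (adc 3 (l s) * adc 2 (l t)) * wd (l(s := adl 3 (l s), t := adl 2 (l t))) X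
   - cst (adc 2 (l s) * adc 3 (l t)) * wd (l(s := adl 2 (l s), t := adl 3 (l t))) X"

text \<open>Move the left leg e_i past the first letter x. The term that passes gives x times the
  sandwich of the rest. In the commutator term [e_i, x] Y e_j the leg e_j is carried back across the
  rest Y: what arrives beside [e_i, x] sums to -(1/2) ad_C x, which is H for x = G and 0 otherwise,
  and the commutators with Y are the pair terms containing x.\<close>

lemma sandwich_insert_min:
  assumes "finite X" "\<forall>s\<in>X. m < s" "\<forall>s. l s < 4"
  shows "sandwich l (insert m X) = gn (l m) * sandwich l X + (if l m = 1 then gn 0 * wd l X else 0)
    - cst (esg (l m)) * (cst (adc 3 (l m)) * gn (adl 3 (l m)) * adw 2 l X
                       - cst (adc 2 (l m)) * gn (adl 2 (l m)) * adw 3 l X)"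
proof -
  have m: "m \<notin> X" using assms by auto
  have w: "wd l (insert m X) = gn (l m) * wd l X" using assms by (simp add: wd_insert_min)
  have p: "psg l (insert m X) = esg (l m) * psg l X" using m assms by (simp add: psg_def)
  define Y where "Y = wd l X"
  have h: "Y * gn 0 = gn 0 * Y" using gn0_wd assms by (simp add: Y_def)
  have q: "cst (psg l X) * Y * gn 2 = gn 2 * Y - adw 2 l X" "cst (psg l X) * Y * gn 3 = gn 3 * Y - adw 3 l X"
    using wd_odd_gn assms by (simp_all add: Y_def)
  \<comment> \<open>Once the sign is a number, the facts \<open>q\<close> become rewrite rules that
    push Q_+ and Q_- to the left of \<open>Y\<close>.\<close>
  consider "psg l X = 1" | "psg l X = -1" using psg_cases by blast
  then show ?thesis
  proof cases
    case 1
    then have "Y * gn 2 = gn 2 * Y - adw 2 l X" "Y * gn 3 = gn 3 * Y - adw 3 l X" using q by auto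
    then show ?thesis
      using 1 h assms(3)[rule_format, of m]
      by (auto elim!: less_4_cases simp: sandwich_def w p esg_def adc_def adl_def oddb_def Y_def[symmetric]
        mult.assoc gl11_PBW distrib_left distrib_right left_diff_distrib right_diff_distrib)
  next
    case 2
    then have "Y * gn 2 = adw 2 l X - gn 2 * Y" "Y * gn 3 = adw 3 l X - gn 3 * Y"
      using q 2 by (simp_all, metis minus_diff_eq minus_minus)+
    then show ?thesis
      using 2 h assms(3)[rule_format, of m]
      by (auto elim!: less_4_cases simp: sandwich_def w p esg_def adc_def adl_def oddb_def Y_def[symmetric]
        mult.assoc gl11_PBW distrib_left distrib_right left_diff_distrib right_diff_distrib)
  qed
qed

text \<open>The identity \<open>\<Sum>C\<^sup>i\<^sup>j e\<^sub>i X e\<^sub>j = c X - (1/2) ad\<^sub>C X\<close>: the first sum comes from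
  \<open>ad\<^sub>C G = -2H\<close>, the double sum from the action of \<open>C\<close> on two different letters.\<close>
lemma sandwich_eq:
  assumes "finite X" "\<forall>s. l s < 4"
  shows "sandwich l X = cas * wd l X + (\<Sum>s\<in>X. if l s = 1 then wd (l(s := 0)) X else 0)
     - (\<Sum>s\<in>X. \<Sum>t\<in>{t\<in>X. s < t}. cst (esg (l s) * psg l {u\<in>X. s < u \<and> u < t}) * casm l s t X)"
  using assms(1)
proof (induction rule: finite_linorder_min_induct)
  case empty
  then show ?case by (simp add: sandwich_def psg_def cas_def)
next
  case (insert m X)
  have m: "m \<notin> X" "\<forall>s\<in>X. m < s" using insert by auto
  have w: "wd l' (insert m X) = gn (l' m) * wd l' X" for l' using insert m by (simp add: wd_insert_min)
  have wm: "wd (l'(m := k)) X = wd l' X" for l' k using m by (intro wd_cong) auto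
  have 1: "(\<Sum>s\<in>insert m X. if l s = 1 then wd (l(s := 0)) (insert m X) else 0)
    = (if l m = 1 then gn 0 * wd l X else 0) + gn (l m) * (\<Sum>s\<in>X. if l s = 1 then wd (l(s := 0)) X else 0)"
    using insert m by (auto simp: w wm sum_distrib_left intro!: sum.cong)
  have c: "casm l s t (insert m X) = gn (l m) * casm l s t X" if "s \<in> X" "t \<in> X" for s t
  proof -
    have "s \<noteq> m" "t \<noteq> m" using that m by auto
    then show ?thesis by (simp add: casm_def w right_diff_distrib cst_normalize)
  qed
  have 2: "(\<Sum>s\<in>X. \<Sum>t\<in>{t\<in>insert m X. s < t}. cst (esg (l s) * psg l {u\<in>insert m X. s < u \<and> u < t}) * casm l s t (insert m X))
    = gn (l m) * (\<Sum>s\<in>X. \<Sum>t\<in>{t\<in>X. s < t}. cst (esg (l s) * psg l {u\<in>X. s < u \<and> u < t}) * casm l s t X)"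
    unfolding sum_distrib_left
  proof (intro sum.cong refl)
    fix s assume s: "s \<in> X"
    show "{t \<in> insert m X. s < t} = {t \<in> X. s < t}" using s m by auto
    fix t assume t: "t \<in> {t \<in> X. s < t}"
    have "{u\<in>insert m X. s < u \<and> u < t} = {u\<in>X. s < u \<and> u < t}" using s m by auto
    then show "cst (esg (l s) * psg l {u\<in>insert m X. s < u \<and> u < t}) * casm l s t (insert m X)
      = gn (l m) * (cst (esg (l s) * psg l {u\<in>X. s < u \<and> u < t}) * casm l s t X)"
      using c s t by (simp add: cst_normalize)
  qed
  \<comment> \<open>The pairs whose left member is the new letter are exactly the commutator terms
    produced by \<open>sandwich_insert_min\<close>.\<close>
  have 3: "(\<Sum>t\<in>{t\<in>insert m X. m < t}. cst (esg (l m) * psg l {u\<in>insert m X. m < u \<and> u < t}) * casm l m t (insert m X))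
    = cst (esg (l m)) * (cst (adc 3 (l m)) * gn (adl 3 (l m)) * adw 2 l X
                       - cst (adc 2 (l m)) * gn (adl 2 (l m)) * adw 3 l X)"
    unfolding adw_def sum_distrib_left sum_subtractf[symmetric]
  proof (intro sum.cong)
    show "{t \<in> insert m X. m < t} = X" using m by auto
    fix t assume t: "t \<in> X"
    have tm: "t \<noteq> m" using t m by auto
    have "{u\<in>insert m X. m < u \<and> u < t} = {u\<in>X. u < t}" using t m by auto
    moreover have "wd (l(m := a, t := b)) X = wd (l(t := b)) X" for a b
      using m by (intro wd_cong) auto
    ultimately show "cst (esg (l m) * psg l {u\<in>insert m X. m < u \<and> u < t}) * casm l m t (insert m X)
      = cst (esg (l m)) * (cst (adc 3 (l m)) * gn (adl 3 (l m)) * (cst (psg l {s \<in> X. s < t} * adc 2 (l t)) * wd (l(t := adl 2 (l t))) X) -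
             cst (adc 2 (l m)) * gn (adl 2 (l m)) * (cst (psg l {s \<in> X. s < t} * adc 3 (l t)) * wd (l(t := adl 3 (l t))) X))"
      using tm by (simp add: casm_def w right_diff_distrib cst_normalize)
  qed
  show ?case
    unfolding sandwich_insert_min[OF insert.hyps(1) m(2) assms(2)] insert.IH 1 w[of l]
      sum.insert[OF insert.hyps(1) m(1)] 2 3
    by (simp add: right_diff_distrib distrib_left cas_commute assms(2) flip: mult.assoc)
qed

section \<open>State sums over chord diagrams\<close>

lemma chord_of_eq:
  assumes "chord_diagram D" "ch \<in> D" "s = fst ch \<or> s = snd ch"
  shows "chord_of D s = ch"
  unfolding chord_of_def
proof (rule the_equality)
  show "ch \<in> D \<and> (fst ch = s \<or> snd ch = s)" using assms by auto
  fix c assume c: "c \<in> D \<and> (fst c = s \<or> snd c = s)"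
  then have "s \<in> {fst c, snd c} \<inter> {fst ch, snd ch}" using assms(3) by auto
  then show "c = ch" using assms(1,2) c unfolding chord_diagram_def by blast
qed

lemma chord_diagram_subset: "chord_diagram D \<Longrightarrow> D' \<subseteq> D \<Longrightarrow> chord_diagram D'"
  unfolding chord_diagram_def by (meson finite_subset subsetD)

lemma finite_endpoints: "chord_diagram D \<Longrightarrow> finite (endpoints D)"
  by (simp add: chord_diagram_def endpoints_def)

lemma endpoints_insert: "endpoints (insert (p, q) D) = insert p (insert q (endpoints D))"
  by (auto simp: endpoints_def)

lemma endpointsE:
  assumes "s \<in> endpoints D"
  obtains ch where "ch \<in> D" "s = fst ch \<or> s = snd ch"
  using assms by (auto simp: endpoints_def)

lemma fresh_endpoints:
  assumes "chord_diagram (insert (p, q) D)" "(p, q) \<notin> D"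
  shows "p \<notin> endpoints D" "q \<notin> endpoints D" "p < q"
  using assms unfolding chord_diagram_def endpoints_def by fastforce+

text \<open>The labelling of the endpoints is extended by the central letter 0 = H, which is even and
  so invisible to Koszul signs.\<close>
definition lab :: "(nat \<times> nat) set \<Rightarrow> (nat \<times> nat \<Rightarrow> nat \<times> nat) \<Rightarrow> nat \<Rightarrow> nat" where
  "lab D \<sigma> s = (if s \<in> endpoints D then label D \<sigma> s else 0)"

definition coef :: "(nat \<times> nat) set \<Rightarrow> (nat \<times> nat \<Rightarrow> nat \<times> nat) \<Rightarrow> complex" where
  "coef D \<sigma> = (\<Prod>ch\<in>D. casC (fst (\<sigma> ch)) (snd (\<sigma> ch))) * koszul D \<sigma>"

text \<open>The integrand is an arbitrary function of the labelling, so chords can also be summed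
  out after some letters have been changed by the adjoint action.\<close>

definition state_sum :: "(nat \<times> nat) set \<Rightarrow> ((nat \<Rightarrow> nat) \<Rightarrow> ugl) \<Rightarrow> ugl" where
  "state_sum D F = (\<Sum>\<sigma>\<in>PiE D (\<lambda>_. {0..<4} \<times> {0..<4}). cst (coef D \<sigma>) * F (lab D \<sigma>))"

lemma fsupp_Wt: "fsupp (Wt D)"
proof -
  have "Wt D = (\<lambda>w. \<Sum>\<sigma>\<in>PiE D (\<lambda>_. {0..<4} \<times> {0..<4}). smul (coef D \<sigma>) (monom_w (cword D \<sigma>)) w)"
    by (simp add: Wt_def coef_def smul_def)
  then show ?thesis by (simp add: fsupp_sum)
qed

lemma abs_Wt:
  assumes "chord_diagram D"
  shows "abs_ugl (Wt D) = state_sum D (\<lambda>l. wd l (endpoints D))"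
proof -
  have "Wt D = (\<lambda>w. \<Sum>\<sigma>\<in>PiE D (\<lambda>_. {0..<4} \<times> {0..<4}). smul (coef D \<sigma>) (monom_w (cword D \<sigma>)) w)"
    by (simp add: Wt_def coef_def smul_def)
  then have "abs_ugl (Wt D) = (\<Sum>\<sigma>\<in>PiE D (\<lambda>_. {0..<4} \<times> {0..<4}). cst (coef D \<sigma>) * word (cword D \<sigma>))"
    by (simp add: abs_ugl_sum abs_ugl_smul abs_ugl_monom)
  moreover have "word (cword D \<sigma>) = wd (lab D \<sigma>) (endpoints D)" for \<sigma>
    using finite_endpoints[OF assms] by (auto simp: wd_def cword_def lab_def intro!: arg_cong[of _ _ word])
  ultimately show ?thesis by (simp add: state_sum_def)
qed

text \<open>Summation over the states of one extra chord \<open>(p, q)\<close>; the Koszul sign of this chord only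
  depends on the odd letters strictly between its endpoints.\<close>
definition peel :: "nat \<Rightarrow> nat \<Rightarrow> ((nat \<Rightarrow> nat) \<Rightarrow> ugl) \<Rightarrow> (nat \<Rightarrow> nat) \<Rightarrow> ugl" where
  "peel p q F l = F (l(p := 1, q := 0)) + F (l(p := 0, q := 1))
     + cst (psg l {p<..<q}) * (F (l(p := 3, q := 2)) - F (l(p := 2, q := 3)))"

text \<open>The share of one ordered pair of positions in the Koszul sign. Written as a product of
  such factors, the sign splits when a chord is added.\<close>

definition inv_sign :: "(nat \<times> nat) set \<Rightarrow> (nat \<times> nat \<Rightarrow> nat \<times> nat) \<Rightarrow> nat \<Rightarrow> nat \<Rightarrow> complex" where
  "inv_sign D \<sigma> s t = (if s < t \<and> oddb (label D \<sigma> s) \<and> oddb (label D \<sigma> t) \<and> refkey D t < refkey D s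
     then -1 else 1)"

lemma koszul_prod:
  assumes "chord_diagram D"
  shows "koszul D \<sigma> = (\<Prod>s\<in>endpoints D. \<Prod>t\<in>endpoints D. inv_sign D \<sigma> s t)"
proof -
  let ?E = "endpoints D"
  let ?P = "\<lambda>(s, t). s < t \<and> oddb (label D \<sigma> s) \<and> oddb (label D \<sigma> t) \<and> refkey D t < refkey D s"
  have fin: "finite (?E \<times> ?E)" using finite_endpoints[OF assms] by simp
  have "(\<Prod>s\<in>?E. \<Prod>t\<in>?E. inv_sign D \<sigma> s t) = (\<Prod>(s, t)\<in>?E \<times> ?E. inv_sign D \<sigma> s t)"
    by (rule prod.cartesian_product)
  also have "\<dots> = (\<Prod>x\<in>?E \<times> ?E. if ?P x then -1 else 1)"
    by (intro prod.cong) (auto simp: inv_sign_def split: if_splits)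
  also have "\<dots> = (-1) ^ card {x\<in>?E \<times> ?E. ?P x}"
    using fin by (simp add: prod.If_cases Int_def)
  also have "{x\<in>?E \<times> ?E. ?P x} = {(s, t). s \<in> ?E \<and> t \<in> ?E \<and> s < t \<and>
       oddb (label D \<sigma> s) \<and> oddb (label D \<sigma> t) \<and> refkey D t < refkey D s}" by auto
  finally show ?thesis by (simp add: koszul_def)
qed

text \<open>The two ends of the new chord are adjacent in the reference order and have equal parity.
  A letter outside the interval between them lies on the same side of both ends in the word as well,
  so it is inverted with both or with neither and its signs cancel. A letter strictly between them
  is inverted with exactly one end.\<close>

lemma koszul_insert:
  assumes cd: "chord_diagram (insert (p, q) D)" and new: "(p, q) \<notin> D" and par: "oddb x = oddb y"
  shows "koszul (insert (p, q) D) (\<sigma>((p, q) := (x, y)))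
    = koszul D \<sigma> * (if oddb x then psg (lab D \<sigma>) {p<..<q} else 1)"
proof -
  let ?D = "insert (p, q) D" and ?s = "\<sigma>((p, q) := (x, y))" and ?E = "endpoints D"
  have cdD: "chord_diagram D" using cd by (rule chord_diagram_subset) auto
  have fE: "finite ?E" using finite_endpoints[OF cdD] .
  note fresh = fresh_endpoints[OF cd new]
  have cp: "chord_of ?D p = (p, q)" "chord_of ?D q = (p, q)"
    by (rule chord_of_eq[OF cd]; simp)+
  have ce: "chord_of ?D s = chord_of D s" if "s \<in> ?E" for s
    using that by (elim endpointsE) (metis cd cdD chord_of_eq insertI2)
  have cD: "chord_of D s \<in> D" if "s \<in> ?E" for s
    using that by (elim endpointsE) (metis cdD chord_of_eq)
  have cb: "fst (chord_of D s) \<le> s" "fst (chord_of D s) \<noteq> p" if "s \<in> ?E" for s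
  proof -
    obtain ch where ch: "ch \<in> D" "s = fst ch \<or> s = snd ch" using \<open>s \<in> ?E\<close> by (elim endpointsE)
    then have "chord_of D s = ch" using cdD chord_of_eq by blast
    moreover have "fst ch < snd ch" using cdD ch by (auto simp: chord_diagram_def)
    moreover have "fst ch \<in> ?E" using ch by (auto simp: endpoints_def)
    ultimately show "fst (chord_of D s) \<le> s" "fst (chord_of D s) \<noteq> p" using ch fresh by auto
  qed
  have lp: "label ?D ?s p = x" "label ?D ?s q = y"
    using fresh by (simp_all add: label_def cp Let_def)
  have le: "label ?D ?s s = label D \<sigma> s" if "s \<in> ?E" for s
    using cD[OF that] new by (auto simp add: label_def ce that Let_def)
  have rp: "refkey ?D p = 2 * p" "refkey ?D q = 2 * p + 1"
    using fresh by (simp_all add: refkey_def cp Let_def)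
  have re: "refkey ?D s = refkey D s" if "s \<in> ?E" for s
    by (simp add: refkey_def ce that)
  have rb: "refkey D s = 2 * fst (chord_of D s) \<or> refkey D s = Suc (2 * fst (chord_of D s))" for s
    by (simp add: refkey_def Let_def)
  let ?k = "inv_sign ?D ?s"
  have k0: "?k s t = inv_sign D \<sigma> s t" if "s \<in> ?E" "t \<in> ?E" for s t
    using that by (simp add: inv_sign_def le re)
  have kpq: "?k p p * ?k p q * ?k q p * ?k q q = 1"
    using fresh by (simp add: inv_sign_def rp)
  have kt: "?k p t * ?k q t * (?k t p * ?k t q)
     = (if t \<in> {p<..<q} then if oddb x then esg (label D \<sigma> t) else 1 else 1)" if "t \<in> ?E" for t
  proof -
    have "t \<noteq> p" "t \<noteq> q" using fresh that by auto
    then show ?thesis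
      using fresh(3) cb[OF that] par rb[of t]
      by (elim disjE) (auto simp add: inv_sign_def lp le re rp that esg_def)
  qed
  have "koszul ?D ?s = (\<Prod>s\<in>insert p (insert q ?E). \<Prod>t\<in>insert p (insert q ?E). ?k s t)"
    by (simp only: koszul_prod[OF cd] endpoints_insert)
  also have "\<dots> = (?k p p * ?k p q * ?k q p * ?k q q)
      * (\<Prod>t\<in>?E. ?k p t * ?k q t * (?k t p * ?k t q)) * (\<Prod>s\<in>?E. \<Prod>t\<in>?E. ?k s t)"
    using fresh fE by (simp add: prod.distrib mult_ac)
  also have "(\<Prod>s\<in>?E. \<Prod>t\<in>?E. ?k s t) = koszul D \<sigma>"
    unfolding koszul_prod[OF cdD] by (intro prod.cong refl k0)
  also have "(\<Prod>t\<in>?E. ?k p t * ?k q t * (?k t p * ?k t q))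
    = (\<Prod>t\<in>?E. if t \<in> {p<..<q} then if oddb x then esg (lab D \<sigma> t) else 1 else 1)"
    by (intro prod.cong refl) (simp only: kt, simp add: lab_def)
  also have "\<dots> = (\<Prod>t\<in>?E \<inter> {p<..<q}. if oddb x then esg (lab D \<sigma> t) else 1)"
    using fE by (simp add: prod.inter_restrict)
  \<comment> \<open>The interval may contain positions that are not endpoints; they carry the
    default letter H, whose sign is 1.\<close>
  also have "\<dots> = (if oddb x then psg (lab D \<sigma>) {p<..<q} else 1)"
  proof -
    have "(\<Prod>t\<in>?E \<inter> {p<..<q}. esg (lab D \<sigma> t)) = psg (lab D \<sigma>) {p<..<q}"
      unfolding psg_def by (rule prod.mono_neutral_left) (auto simp: lab_def esg_def oddb_def)
    then show ?thesis by simp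
  qed
  finally show ?thesis by (simp only: kpq) simp
qed

lemma lab_insert:
  assumes cd: "chord_diagram (insert (p, q) D)" and new: "(p, q) \<notin> D"
  shows "lab (insert (p, q) D) (\<sigma>((p, q) := (x, y))) = (lab D \<sigma>)(p := x, q := y)"
proof
  fix s
  have cdD: "chord_diagram D" using cd by (rule chord_diagram_subset) auto
  note fresh = fresh_endpoints[OF cd new]
  have cp: "chord_of (insert (p, q) D) p = (p, q)" "chord_of (insert (p, q) D) q = (p, q)"
    by (rule chord_of_eq[OF cd]; simp)+
  show "lab (insert (p, q) D) (\<sigma>((p, q) := (x, y))) s = ((lab D \<sigma>)(p := x, q := y)) s"
  proof (cases "s \<in> endpoints D")
    case True
    then obtain ch where ch: "ch \<in> D" "s = fst ch \<or> s = snd ch" by (elim endpointsE)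
    then have "chord_of D s = ch" "chord_of (insert (p, q) D) s = ch"
      using cd cdD chord_of_eq by (blast intro: chord_of_eq)+
    moreover have "ch \<noteq> (p, q)" using ch new by auto
    ultimately show ?thesis using True fresh
      by (auto simp: lab_def label_def Let_def endpoints_insert)
  next
    case False
    then show ?thesis using fresh by (auto simp: lab_def label_def cp endpoints_insert)
  qed
qed

lemma state_sum_insert:
  assumes cd: "chord_diagram (insert (p, q) D)" and new: "(p, q) \<notin> D"
  shows "state_sum (insert (p, q) D) F = state_sum D (peel p q F)"
proof -
  let ?B = "{0..<4} \<times> {0..<4} :: (nat \<times> nat) set"
  let ?g = "\<lambda>(x, y) l. cst (casC x y * (if oddb x then psg l {p<..<q} else 1)) * F (l(p := x, q := y))"
  have fD: "finite D" using cd by (simp add: chord_diagram_def)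
  have co: "coef (insert (p, q) D) (\<sigma>((p, q) := (x, y)))
     = coef D \<sigma> * (casC x y * (if oddb x then psg (lab D \<sigma>) {p<..<q} else 1))" for \<sigma> x y
  proof (cases "oddb x = oddb y")
    case True
    have "(\<Prod>ch\<in>D. casC (fst ((\<sigma>((p, q) := (x, y))) ch)) (snd ((\<sigma>((p, q) := (x, y))) ch)))
      = (\<Prod>ch\<in>D. casC (fst (\<sigma> ch)) (snd (\<sigma> ch)))"
      using new by (intro prod.cong) auto
    then show ?thesis
      using fD new by (simp add: coef_def koszul_insert[OF cd new True])
  next
    case False
    \<comment> \<open>The tensor C is even, so the labels of unequal parity, which
      \<open>koszul_insert\<close> does not cover, have coefficient 0.\<close>
    then have "casC x y = 0" by (auto simp: casC_def oddb_def)
    then show ?thesis using fD new by (simp add: coef_def)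
  qed
  have inj: "inj_on (\<lambda>(v, \<sigma>). \<sigma>((p, q) := v)) (?B \<times> PiE D (\<lambda>_. ?B))"
    using inj_combinator[OF new, of "\<lambda>_. ?B"] by simp
  have "state_sum (insert (p, q) D) F
     = (\<Sum>(v, \<sigma>)\<in>?B \<times> PiE D (\<lambda>_. ?B). cst (coef (insert (p, q) D) (\<sigma>((p, q) := v)))
          * F (lab (insert (p, q) D) (\<sigma>((p, q) := v))))"
    unfolding state_sum_def PiE_insert_eq sum.reindex[OF inj]
    by (simp add: case_prod_unfold)
  also have "\<dots> = (\<Sum>(v, \<sigma>)\<in>?B \<times> PiE D (\<lambda>_. ?B). cst (coef D \<sigma>) * ?g v (lab D \<sigma>))"
    by (intro sum.cong refl) (auto simp: co lab_insert[OF cd new] mult.assoc)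
  also have "\<dots> = (\<Sum>\<sigma>\<in>PiE D (\<lambda>_. ?B). \<Sum>v\<in>?B. cst (coef D \<sigma>) * ?g v (lab D \<sigma>))"
    by (subst sum.cartesian_product[symmetric]) (rule sum.swap)
  also have "\<dots> = (\<Sum>\<sigma>\<in>PiE D (\<lambda>_. ?B). cst (coef D \<sigma>) * peel p q F (lab D \<sigma>))"
  proof (intro sum.cong refl)
    fix \<sigma>
    have pairs: "(\<Sum>v\<in>?B. h v) = (\<Sum>x\<in>{0,1,2,3}. \<Sum>y\<in>{0,1,2,3}. h (x, y))" for h :: "nat \<times> nat \<Rightarrow> ugl"
    proof -
      have "{0..<4} = {0, 1, 2, 3 :: nat}" by auto
      then show ?thesis by (simp only: sum.cartesian_product case_prod_unfold prod.collapse)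
    qed
    have "(\<Sum>v\<in>?B. ?g v l) = peel p q F l" for l
      unfolding pairs by (simp add: peel_def casC_def oddb_def right_diff_distrib)
    then show "(\<Sum>v\<in>?B. cst (coef D \<sigma>) * ?g v (lab D \<sigma>)) = cst (coef D \<sigma>) * peel p q F (lab D \<sigma>)"
      by (simp only: sum_distrib_left[symmetric])
  qed
  finally show ?thesis by (simp add: state_sum_def)
qed

section \<open>The Casimir tensor acting on two chords\<close>

lemma psg_upd:
  assumes "l w = 0"
  shows "psg (l(w := i)) {x<..<y} = (if x < w \<and> w < y then esg i else 1) * psg l {x<..<y}"
proof (cases "w \<in> {x<..<y}")
  case True
  then have "{x<..<y} = insert w ({x<..<y} - {w})" by auto
  then have "psg l' {x<..<y} = esg (l' w) * psg l' ({x<..<y} - {w})" for l'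
    unfolding psg_def by (subst prod.insert_remove[symmetric]) auto
  moreover have "psg (l(w := i)) ({x<..<y} - {w}) = psg l ({x<..<y} - {w})"
    unfolding psg_def by (intro prod.cong) auto
  ultimately show ?thesis using True assms by (simp add: esg_def oddb_def)
next
  case False
  then show ?thesis unfolding psg_def by (auto intro!: prod.cong)
qed

lemma psg_square: "psg l X * psg l X = 1"
  using psg_cases[of l X] by auto

text \<open>Signs are their own inverses, so an interval is a quotient of two initial segments. A
  sign attached to a pair of points thus becomes a product of one factor per point, insensitive to
  their order.\<close>

lemma psg_between:
  assumes "x < y" "l x = 0"
  shows "psg l {x<..<y} = psg l {..<x} * psg l {..<y}"
proof -
  have *: "{..<y} = {..<x} \<union> insert x {x<..<y}" using assms(1) by auto
  have "psg l {..<y} = psg l {..<x} * psg l (insert x {x<..<y})"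
    unfolding psg_def * by (rule prod.union_disjoint) auto
  also have "psg l (insert x {x<..<y}) = psg l {x<..<y}"
    using assms(2) by (simp add: psg_def esg_def oddb_def)
  finally show ?thesis by (simp only: psg_square mult_1 flip: mult.assoc)
qed

text \<open>The chords created by the recursion join two points whose order is not known in
  advance.\<close>

definition peelu :: "nat \<Rightarrow> nat \<Rightarrow> ((nat \<Rightarrow> nat) \<Rightarrow> ugl) \<Rightarrow> (nat \<Rightarrow> nat) \<Rightarrow> ugl" where
  "peelu x y = peel (min x y) (max x y)"

text \<open>The summand of the double sum in \<open>sandwich_eq\<close>, with the word replaced by
  an arbitrary function \<open>G\<close> of the labelling.\<close>

definition ad_pair :: "((nat \<Rightarrow> nat) \<Rightarrow> ugl) \<Rightarrow> nat \<Rightarrow> nat \<Rightarrow> (nat \<Rightarrow> nat) \<Rightarrow> ugl" where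
  "ad_pair G s t l = cst (esg (l s) * psg l {s<..<t}) *
    (cst (adc 3 (l s) * adc 2 (l t)) * G (l(s := adl 3 (l s), t := adl 2 (l t)))
   - cst (adc 2 (l s) * adc 3 (l t)) * G (l(s := adl 2 (l s), t := adl 3 (l t))))"

text \<open>The order of \<open>x\<close> and \<open>y\<close> survives only as the sign of the odd
  part, because the odd part of C is antisymmetric.\<close>

lemma peelu_eq:
  assumes "x \<noteq> y" "l x = 0" "l y = 0"
  shows "peelu x y F l = F (l(x := 1, y := 0)) + F (l(x := 0, y := 1))
     + cst (psg l {..<x}) * (cst (psg l {..<y}) * (if x < y then F (l(x := 3, y := 2)) - F (l(x := 2, y := 3))
          else F (l(x := 2, y := 3)) - F (l(x := 3, y := 2))))"
proof (cases "x < y")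
  case True
  then show ?thesis using assms
    by (simp add: peelu_def peel_def psg_between mult.assoc)
next
  case False
  then have "y < x" using assms(1) by simp
  then show ?thesis using assms(2,3) cst_left_commute
    by (simp add: peelu_def peel_def psg_between mult.assoc fun_upd_twist[of x y])
qed

lemma psg_below_upd:
  assumes "l w = 0"
  shows "psg (l(w := i)) {..<y} = (if w < y then esg i else 1) * psg l {..<y}"
proof (cases "w < y")
  case True
  then have *: "{..<y} = insert w ({..<y} - {w})" by auto
  have "psg l' {..<y} = esg (l' w) * psg l' ({..<y} - {w})" for l'
    unfolding psg_def by (subst *, subst prod.insert) auto
  moreover have "psg (l(w := i)) ({..<y} - {w}) = psg l ({..<y} - {w})"
    unfolding psg_def by (intro prod.cong) auto
  ultimately show ?thesis using True assms by (simp add: esg_def oddb_def)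
next
  case False
  then show ?thesis unfolding psg_def by (auto intro!: prod.cong)
qed

text \<open>The four-leg tensor obtained by contracting two structure tensors is a combination of
  \<open>H \<otimes> H \<otimes> C\<close>; the letter 0 = H stays at the two endpoints that are not mentioned.\<close>
lemma four_point:
  fixes s s' t t' :: nat
  assumes z: "l s = 0" "l s' = 0" "l t = 0" "l t' = 0"
    and d: "s \<noteq> s'" "s \<noteq> t'" "s' \<noteq> t" "s' \<noteq> t'" "t \<noteq> t'" and st: "s < t"
  shows "peelu s s' (peelu t t' (ad_pair G s t)) l
    = peelu s t' G l + peelu s' t G l - peelu s t G l - peelu s' t' G l"
proof -
  \<comment> \<open>Every occurrence of \<open>G\<close> is normalised to a value
    \<open>Q i j k m\<close> at the four points, which reduces the claim to a linear identity with
    signs as coefficients.\<close>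
  define Q where "Q i j k m = G (l(s := i, s' := j, t := k, t' := m))" for i j k m
  have ne: "s' \<noteq> s" "t' \<noteq> s" "t \<noteq> s'" "t' \<noteq> s'" "t' \<noteq> t" "s \<noteq> t" "t \<noteq> s" using d st by auto
  have Q0: "G (l(s := i, s' := j, t := k, t' := m)) = Q i j k m" for i j k m
    by (simp only: Q_def)
  have tw: "f(s' := a, s := b) = f(s := b, s' := a)" "f(t := a, s := b) = f(s := b, t := a)"
    "f(t' := a, s := b) = f(s := b, t' := a)" "f(t := a, s' := b) = f(s' := b, t := a)"
    "f(t' := a, s' := b) = f(s' := b, t' := a)" "f(t' := a, t := b) = f(t := b, t' := a)"
    for f :: "nat \<Rightarrow> nat" and a b
    using d ne by (simp_all add: fun_upd_twist)
  have Q1: "G (l(s := i, s' := j, t := k, t' := m, s := i', t := k')) = Q i' j k' m" for i j k m i' k'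
    unfolding Q_def by (simp only: tw fun_upd_upd)
  have lz: "l = l(s := 0)" "l = l(s' := 0)" "l = l(t := 0)" "l = l(t' := 0)"
    using z by (simp_all add: fun_upd_idem)
  have Q2: "G (l(s := i, t' := m)) = Q i 0 0 m" for i m
    unfolding Q_def by (subst lz(3), subst lz(2)) (simp only: tw)
  have Q3: "G (l(s' := j, t := k)) = Q 0 j k 0" for j k
    unfolding Q_def by (subst lz(4), subst lz(1)) (simp only: tw)
  have Q4: "G (l(s := i, t := k)) = Q i 0 k 0" for i k
    unfolding Q_def by (subst lz(4), subst lz(2)) (simp only: tw)
  have Q5: "G (l(s' := j, t' := m)) = Q 0 j 0 m" for j m
    unfolding Q_def by (subst lz(3), subst lz(1)) (simp only: tw)
  have P: "psg (l(s := i, s' := j, t := k, t' := m)) {s<..<t}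
    = (if s < t' \<and> t' < t then esg m else 1) * ((if s < s' \<and> s' < t then esg j else 1) * (psg l {..<s} * psg l {..<t}))"
    for i j k m
  proof -
    have "psg (l(s := i, s' := j, t := k, t' := m)) {s<..<t}
      = (if s < t' \<and> t' < t then esg m else 1) * psg (l(s := i, s' := j, t := k)) {s<..<t}"
      using z d ne by (intro psg_upd) simp
    also have "psg (l(s := i, s' := j, t := k)) {s<..<t} = psg (l(s := i, s' := j)) {s<..<t}"
      using z d ne by (subst psg_upd) simp_all
    also have "\<dots> = (if s < s' \<and> s' < t then esg j else 1) * psg (l(s := i)) {s<..<t}"
      using z d ne by (intro psg_upd) simp
    also have "psg (l(s := i)) {s<..<t} = psg l {s<..<t}"
      using z d ne by (subst psg_upd) simp_all
    also have "\<dots> = psg l {..<s} * psg l {..<t}"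
      by (rule psg_between[of s t l, OF st z(1)])
    finally show ?thesis .
  qed
  have ap: "(l(s := i, s' := j, t := k, t' := m)) s = i" "(l(s := i, s' := j, t := k, t' := m)) t = k" for i j k m
    using d ne by simp_all
  have R: "ad_pair G s t (l(s := i, s' := j, t := k, t' := m)) =
     cst (esg i * (if s < s' \<and> s' < t then esg j else 1) * (if s < t' \<and> t' < t then esg m else 1)) *
     (cst (psg l {..<s}) * (cst (psg l {..<t}) *
    (cst (adc 3 i * adc 2 k) * Q (adl 3 i) j (adl 2 k) m
   - cst (adc 2 i * adc 3 k) * Q (adl 2 i) j (adl 3 k) m)))" for i j k m
    unfolding ad_pair_def ap P Q1 by (simp only: cst_simps cst_normalize)
  have sq: "cst (psg l X) * (cst (psg l X) * u) = u" for X u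
    using psg_cases[of l X] by auto
  have par: "esg 0 = 1" "esg (Suc 0) = 1" "esg 2 = -1" "esg 3 = -1"
    by (simp_all add: esg_def oddb_def)
  note ev = par adc_def adl_def
  have L: "peelu t t' (ad_pair G s t) (l(s := i, s' := j)) =
     ad_pair G s t (l(s := i, s' := j, t := 1, t' := 0)) + ad_pair G s t (l(s := i, s' := j, t := 0, t' := 1))
     + cst ((if s < t then esg i else 1) * (if s' < t then esg j else 1) * (if s < t' then esg i else 1) * (if s' < t' then esg j else 1))
      * (cst (psg l {..<t}) * (cst (psg l {..<t'}) * (if t < t' then ad_pair G s t (l(s := i, s' := j, t := 3, t' := 2)) - ad_pair G s t (l(s := i, s' := j, t := 2, t' := 3))
          else ad_pair G s t (l(s := i, s' := j, t := 2, t' := 3)) - ad_pair G s t (l(s := i, s' := j, t := 3, t' := 2)))))" for i j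
    using d ne z by (subst peelu_eq) (simp_all add: psg_below_upd cst_normalize)
  note expand = peelu_eq[of s s' l, OF d(1) z(1,2)] peelu_eq[of s t' l, OF d(2) z(1,4)] peelu_eq[of s' t l, OF d(3) z(2,3)]
    peelu_eq[of s t l, OF ne(6) z(1,3)] peelu_eq[of s' t' l, OF d(4) z(2,4)]
  \<comment> \<open>On the right \<open>Q 1 0 0 0\<close> and its three analogues each occur once
    with either sign and cancel. The remaining terms have two odd letters, with signs depending on
    the order of the four points: \<open>s < t\<close> is given, the other five comparisons are
    split.\<close>
  show ?thesis
    unfolding expand L R Q2 Q3 Q4 Q5
    by (cases "s < s'"; cases "s < t'"; cases "s' < t"; cases "s' < t'"; cases "t < t'";
      use st ne(5) in \<open>simp add: ev right_diff_distrib distrib_left cst_left_commute sq\<close>)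
qed

section \<open>The recursion\<close>

text \<open>What pointwise identities under a state sum may use about a labelling, without
  mentioning the state it comes from.\<close>

definition adm :: "nat set \<Rightarrow> (nat \<Rightarrow> nat) \<Rightarrow> bool" where
  "adm E l \<longleftrightarrow> (\<forall>s. l s < 4) \<and> (\<forall>s. s \<notin> E \<longrightarrow> l s = 0)"

lemma adm_lab:
  assumes "chord_diagram D" "\<sigma> \<in> PiE D (\<lambda>_. {0..<4} \<times> {0..<4})"
  shows "adm (endpoints D) (lab D \<sigma>)"
proof -
  have "lab D \<sigma> s < 4" for s
  proof (cases "s \<in> endpoints D")
    case True
    then obtain ch where ch: "ch \<in> D" "s = fst ch \<or> s = snd ch" by (elim endpointsE)
    then have "chord_of D s = ch" using assms(1) chord_of_eq by blast
    moreover have "\<sigma> ch \<in> {0..<4} \<times> {0..<4}" using ch(1) assms(2) by auto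
    ultimately show ?thesis by (auto simp: lab_def label_def Let_def mem_Times_iff)
  qed (simp add: lab_def)
  then show ?thesis by (simp add: adm_def lab_def)
qed

lemma state_sum_cong:
  assumes "chord_diagram D" "\<And>l. adm (endpoints D) l \<Longrightarrow> F l = G l"
  shows "state_sum D F = state_sum D G"
  unfolding state_sum_def using assms adm_lab by (intro sum.cong refl) auto

lemma state_sum_add: "state_sum D (\<lambda>l. F l + G l) = state_sum D F + state_sum D G"
  by (simp add: state_sum_def distrib_left sum.distrib)

lemma state_sum_diff: "state_sum D (\<lambda>l. F l - G l) = state_sum D F - state_sum D G"
  by (simp add: state_sum_def right_diff_distrib sum_subtractf)

lemma state_sum_sum: "state_sum D (\<lambda>l. \<Sum>i\<in>I. F i l) = (\<Sum>i\<in>I. state_sum D (F i))"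
  unfolding state_sum_def sum_distrib_left by (rule sum.swap)

lemma state_sum_mult: "state_sum D (\<lambda>l. x * F l) = x * state_sum D F"
  unfolding state_sum_def sum_distrib_left
proof (intro sum.cong refl)
  fix \<sigma>
  show "cst (coef D \<sigma>) * (x * F (lab D \<sigma>)) = x * (cst (coef D \<sigma>) * F (lab D \<sigma>))"
    by (simp only: cst_commute[of x] flip: mult.assoc)
qed

section \<open>Splitting words and extracting the central letter H\<close>

lemma wd_union:
  assumes "finite X" "finite Y" "\<forall>x\<in>X. \<forall>y\<in>Y. x < y"
  shows "wd l (X \<union> Y) = wd l X * wd l Y"
  using assms(1,3)
proof (induction rule: finite_linorder_min_induct)
  case (insert b X)
  then have "wd l (insert b (X \<union> Y)) = gn (l b) * wd l (X \<union> Y)"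
    using assms(2) by (intro wd_insert_min) auto
  then show ?case using insert by (simp add: wd_insert_min mult.assoc)
qed simp

lemma wd_around:
  assumes "finite X" "s \<in> X"
  shows "wd l X = wd l {x\<in>X. x < s} * gn (l s) * wd l {x\<in>X. s < x}"
proof -
  have "X = {x\<in>X. x < s} \<union> insert s {x\<in>X. s < x}" using assms(2) by auto
  then have "wd l X = wd l ({x\<in>X. x < s} \<union> insert s {x\<in>X. s < x})" by (rule arg_cong)
  also have "\<dots> = wd l {x\<in>X. x < s} * wd l (insert s {x\<in>X. s < x})"
    using assms(1) by (intro wd_union) auto
  also have "wd l (insert s {x\<in>X. s < x}) = gn (l s) * wd l {x\<in>X. s < x}"
    using assms(1) by (intro wd_insert_min) auto
  finally show ?thesis by (simp only: mult.assoc)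
qed

text \<open>H is central, so it can be moved to the front from wherever it stands. This is how the
  endpoints of removed chords leave the word.\<close>

lemma wd_zero:
  assumes "finite X" "s \<notin> X" "l s = 0" "\<forall>s. l s < 4"
  shows "wd l (insert s X) = gn 0 * wd l X"
proof -
  have *: "{x \<in> insert s X. x < s} = {x \<in> X. x < s}" "{x \<in> insert s X. s < x} = {x \<in> X. s < x}" by auto
  have "X = {x\<in>X. x < s} \<union> {x\<in>X. s < x}" using assms(2) by (auto intro: linorder_neqE_nat)
  then have "wd l X = wd l ({x\<in>X. x < s} \<union> {x\<in>X. s < x})" by (rule arg_cong)
  also have "\<dots> = wd l {x\<in>X. x < s} * wd l {x\<in>X. s < x}"
    using assms(1) by (intro wd_union) auto
  finally have X: "wd l X = wd l {x\<in>X. x < s} * wd l {x\<in>X. s < x}" .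
  have "wd l {x\<in>X. x < s} * gn 0 = gn 0 * wd l {x\<in>X. x < s}"
    using assms by (intro gn0_wd) auto
  then show ?thesis
    using wd_around[of "insert s X" s l] assms(1,3) by (simp only: * X finite_insert insertI1 mult.assoc simp_thms)
qed

abbreviation hh :: ugl where "hh \<equiv> gn 0 * gn 0"

lemma wd_zero2:
  assumes "finite X" "s \<notin> X" "t \<notin> X" "s \<noteq> t" "l s = 0" "l t = 0" "\<forall>s. l s < 4"
  shows "wd l (insert s (insert t X)) = hh * wd l X"
  using assms by (simp add: wd_zero mult.assoc)

definition cw :: "(nat \<times> nat) set \<Rightarrow> ugl" where
  "cw D = state_sum D (\<lambda>l. wd l (endpoints D))"

lemma psg_cong: "(\<And>s. s \<in> X \<Longrightarrow> l s = l' s) \<Longrightarrow> psg l X = psg l' X"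
  unfolding psg_def by (rule prod.cong) auto

text \<open>The positions occur in the order \<open>A\<close>, \<open>p\<close>, \<open>L\<close>,
  \<open>q\<close>, \<open>B\<close>, so summing out the chord puts \<open>sandwich l L\<close>
  between the words of \<open>A\<close> and \<open>B\<close>. After \<open>sandwich_eq\<close> the
  Casimir element is moved past \<open>A\<close> by centrality. All this happens for a fixed
  labelling; only then are the states of \<open>D\<close> summed.\<close>

lemma chord_expansion:
  assumes cd: "chord_diagram (insert (p, q) D)" and new: "(p, q) \<notin> D"
  defines "E \<equiv> endpoints D"
  defines "L \<equiv> {s\<in>E. p < s \<and> s < q}"
  shows "cw (insert (p, q) D) = cas * cw D
     + (\<Sum>s\<in>L. state_sum D (\<lambda>l. if l s = 1 then wd (l(s := 0)) E else 0))
     - (\<Sum>s\<in>L. \<Sum>t\<in>{t\<in>L. s < t}. state_sum D (ad_pair (\<lambda>l. wd l E) s t))"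
proof -
  have cdD: "chord_diagram D" using cd by (rule chord_diagram_subset) auto
  note fresh = fresh_endpoints[OF cd new, folded E_def]
  have fE: "finite E" using finite_endpoints[OF cdD] by (simp add: E_def)
  define A where "A = {s\<in>E. s < p}"
  define B where "B = {s\<in>E. q < s}"
  have fin: "finite A" "finite L" "finite B" using fE by (simp_all add: A_def B_def L_def)
  have E: "E = A \<union> (L \<union> B)"
    using fresh unfolding A_def B_def L_def
    by (intro set_eqI) (metis (mono_tags, lifting) UnI1 UnI2 UnE linorder_neqE_nat mem_Collect_eq)
  have wE: "wd l E = wd l A * (wd l L * wd l B)" for l
  proof -
    have "wd l (L \<union> B) = wd l L * wd l B"
      using fin by (intro wd_union) (auto simp: L_def B_def)
    moreover have "wd l (A \<union> (L \<union> B)) = wd l A * wd l (L \<union> B)"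
      using fin fresh by (intro wd_union) (auto simp: A_def L_def B_def)
    ultimately show ?thesis unfolding E by simp
  qed
  have wI: "wd l (insert p (insert q E)) = wd l A * (gn (l p) * (wd l L * (gn (l q) * wd l B)))" for l
  proof -
    have eq: "insert p (insert q E) = A \<union> insert p (L \<union> insert q B)" unfolding E by auto
    have "wd l (L \<union> insert q B) = wd l L * (gn (l q) * wd l B)"
      using fin by (subst wd_union) (auto simp: L_def B_def wd_insert_min)
    moreover have "wd l (A \<union> insert p (L \<union> insert q B)) = wd l A * wd l (insert p (L \<union> insert q B))"
      using fin fresh by (intro wd_union) (auto simp: A_def L_def B_def)
    moreover have "wd l (insert p (L \<union> insert q B)) = gn (l p) * wd l (L \<union> insert q B)"
      using fin fresh by (intro wd_insert_min) (auto simp: A_def L_def B_def)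
    ultimately show ?thesis unfolding eq by simp
  qed
  have loc: "wd (l(s := i)) X = wd l X" if "s \<notin> X" for l s i X
    using that by (intro wd_cong) auto
  have nin: "p \<notin> A" "q \<notin> A" "p \<notin> L" "q \<notin> L" "p \<notin> B" "q \<notin> B"
    using fresh by (auto simp: A_def L_def B_def)
  have main: "peel p q (\<lambda>l. wd l (insert p (insert q E))) l = cas * wd l E
     + (\<Sum>s\<in>L. if l s = 1 then wd (l(s := 0)) E else 0)
     - (\<Sum>s\<in>L. \<Sum>t\<in>{t\<in>L. s < t}. ad_pair (\<lambda>l. wd l E) s t l)" if adm: "adm E l" for l
  proof -
    have l4: "\<forall>s. l s < 4" using adm by (simp add: adm_def)
    have psgL: "psg l {p<..<q} = psg l L"
      unfolding psg_def using adm
      by (intro prod.mono_neutral_right) (auto simp: L_def adm_def esg_def oddb_def)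
    have ins: "psg l {u \<in> L. s < u \<and> u < t} = psg l {s<..<t}" if "s \<in> L" "t \<in> L" for s t
      unfolding psg_def using adm that
      by (intro prod.mono_neutral_left) (auto simp: L_def adm_def esg_def oddb_def)
    have "peel p q (\<lambda>l. wd l (insert p (insert q E))) l = wd l A * sandwich l L * wd l B"
      using fresh(3)
      by (simp add: peel_def wI loc nin sandwich_def psgL distrib_left distrib_right
          left_diff_distrib right_diff_distrib mult.assoc)
        (simp add: wd_def cst_normalize)
    also have "\<dots> = wd l A * cas * (wd l L * wd l B)
        + (\<Sum>s\<in>L. wd l A * (if l s = 1 then wd (l(s := 0)) L else 0) * wd l B)
        - (\<Sum>s\<in>L. \<Sum>t\<in>{t\<in>L. s < t}. wd l A * (cst (esg (l s) * psg l {u\<in>L. s < u \<and> u < t}) * casm l s t L) * wd l B)"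
      unfolding sandwich_eq[OF fin(2) l4]
      by (simp add: distrib_left distrib_right left_diff_distrib right_diff_distrib mult.assoc
          sum_distrib_left sum_distrib_right)
    also have "wd l A * cas * (wd l L * wd l B) = cas * wd l E"
      using cas_wd[OF fin(1) l4] by (simp add: wE mult.assoc)
    also have "(\<Sum>s\<in>L. wd l A * (if l s = 1 then wd (l(s := 0)) L else 0) * wd l B)
      = (\<Sum>s\<in>L. if l s = 1 then wd (l(s := 0)) E else 0)"
    proof (intro sum.cong refl)
      fix s assume "s \<in> L"
      then have "s \<notin> A" "s \<notin> B" by (auto simp: A_def B_def L_def)
      then show "wd l A * (if l s = 1 then wd (l(s := 0)) L else 0) * wd l B
        = (if l s = 1 then wd (l(s := 0)) E else 0)"
        by (simp add: wE loc mult.assoc)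
    qed
    also have "(\<Sum>s\<in>L. \<Sum>t\<in>{t\<in>L. s < t}. wd l A * (cst (esg (l s) * psg l {u\<in>L. s < u \<and> u < t}) * casm l s t L) * wd l B)
      = (\<Sum>s\<in>L. \<Sum>t\<in>{t\<in>L. s < t}. ad_pair (\<lambda>l. wd l E) s t l)"
    proof (intro sum.cong refl)
      fix s t assume s: "s \<in> L" and "t \<in> {t\<in>L. s < t}"
      then have t: "t \<in> L" by simp
      have "s \<notin> A" "s \<notin> B" "t \<notin> A" "t \<notin> B" using s t by (auto simp: A_def B_def L_def)
      then show "wd l A * (cst (esg (l s) * psg l {u\<in>L. s < u \<and> u < t}) * casm l s t L) * wd l B
        = ad_pair (\<lambda>l. wd l E) s t l"
        by (simp add: ins s t ad_pair_def casm_def wE loc left_diff_distrib right_diff_distrib mult.assoc)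
          (simp add: wd_def cst_normalize)
    qed
    finally show ?thesis .
  qed
  have "cw (insert (p, q) D) = state_sum D (\<lambda>l. cas * wd l E
     + (\<Sum>s\<in>L. if l s = 1 then wd (l(s := 0)) E else 0)
     - (\<Sum>s\<in>L. \<Sum>t\<in>{t\<in>L. s < t}. ad_pair (\<lambda>l. wd l E) s t l))"
    unfolding cw_def state_sum_insert[OF cd new] endpoints_insert
    by (rule state_sum_cong[OF cdD]) (use main in \<open>simp add: E_def\<close>)
  then show ?thesis
    by (simp add: state_sum_diff state_sum_add state_sum_mult state_sum_sum cw_def E_def)
qed

text \<open>Of the four states of the chord only the one with G at \<open>s\<close> and H at the
  other end survives; replacing G by H leaves two central letters.\<close>

lemma single_term:
  assumes cd: "chord_diagram (insert (u, v) D)" and new: "(u, v) \<notin> D" and s: "s = u \<or> s = v"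
  defines "E \<equiv> endpoints (insert (u, v) D)"
  shows "state_sum (insert (u, v) D) (\<lambda>l. if l s = 1 then wd (l(s := 0)) E else 0) = hh * cw D"
proof -
  have cdD: "chord_diagram D" using cd by (rule chord_diagram_subset) auto
  note fresh = fresh_endpoints[OF cd new]
  have "peel u v (\<lambda>l. if l s = 1 then wd (l(s := 0)) E else 0) l = hh * wd l (endpoints D)"
    if "adm (endpoints D) l" for l
  proof -
    have z: "l u = 0" "l v = 0" "\<forall>s. l s < 4" using that fresh by (auto simp: adm_def)
    have "l(u := 0, v := 0) = l" "l(u := 0) = l" "l(v := 0, u := 0) = l" using z by (auto simp: fun_eq_iff)
    then have "peel u v (\<lambda>l. if l s = 1 then wd (l(s := 0)) E else 0) l = wd l E"
      using s fresh z by (auto simp: peel_def fun_upd_twist[of v u])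
    also have "\<dots> = hh * wd l (endpoints D)"
      using fresh z finite_endpoints[OF cdD] unfolding E_def endpoints_insert by (intro wd_zero2) auto
    finally show ?thesis .
  qed
  then show ?thesis
    unfolding state_sum_insert[OF cd new] cw_def state_sum_mult[symmetric]
    by (intro state_sum_cong[OF cdD])
qed

text \<open>States with letters G and H vanish, since ad(Q) kills H. Each of the two odd states
  turns both letters into H, and its signs multiply to 1. The total equals the sum of the single
  terms at the two ends, against which it cancels in the recursion.\<close>

lemma same_chord_term:
  assumes cd: "chord_diagram (insert (u, v) D)" and new: "(u, v) \<notin> D"
  defines "E \<equiv> endpoints (insert (u, v) D)"
  shows "state_sum (insert (u, v) D) (ad_pair (\<lambda>l. wd l E) u v) = hh * cw D + hh * cw D"
proof -
  have cdD: "chord_diagram D" using cd by (rule chord_diagram_subset) auto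
  note fresh = fresh_endpoints[OF cd new]
  have "peel u v (ad_pair (\<lambda>l. wd l E) u v) l = hh * wd l (endpoints D) + hh * wd l (endpoints D)"
    if "adm (endpoints D) l" for l
  proof -
    have z: "l u = 0" "l v = 0" "\<forall>s. l s < 4" using that fresh by (auto simp: adm_def)
    have l0: "l(u := 0, v := 0) = l" using z by (auto simp: fun_eq_iff)
    have up: "l(u := i, v := j, u := i', v := j') = l(u := i', v := j')" for i j i' j'
      by (auto simp: fun_eq_iff)
    have ps: "psg (l(u := i, v := j)) {u<..<v} = psg l {u<..<v}" for i j
      by (intro psg_cong) auto
    have sq: "cst (psg l X) * (cst (psg l X) * w) = w" for X w
      using psg_cases[of l X] by auto
    have "peel u v (ad_pair (\<lambda>l. wd l E) u v) l = wd l E + wd l E"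
      using fresh(3)
      by (simp add: peel_def ad_pair_def up ps l0 adc_def adl_def esg_def oddb_def distrib_left sq)
    also have "wd l E = hh * wd l (endpoints D)"
      using fresh z finite_endpoints[OF cdD] unfolding E_def endpoints_insert by (intro wd_zero2) auto
    finally show ?thesis .
  qed
  then show ?thesis
    unfolding state_sum_insert[OF cd new] cw_def state_sum_mult[symmetric] state_sum_add[symmetric]
    by (intro state_sum_cong[OF cdD])
qed

section \<open>Reconnecting the ends of two chords\<close>

lemma mkchord_commute: "mkchord x y = mkchord y x"
  by (simp add: mkchord_def min.commute max.commute)

lemma endpoints_insert_mkchord: "endpoints (insert (mkchord x y) D) = insert x (insert y (endpoints D))"
  by (auto simp: mkchord_def endpoints_insert min_def max_def)

lemma chord_diagram_insert:
  assumes "chord_diagram D" "x \<notin> endpoints D" "y \<notin> endpoints D" "x < y"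
  shows "chord_diagram (insert (x, y) D)" "(x, y) \<notin> D"
proof -
  have *: "{x, y} \<inter> {fst c, snd c} = {}" if "c \<in> D" for c
    using that assms by (auto simp: endpoints_def)
  show "(x, y) \<notin> D" using *[of "(x, y)"] by auto
  show "chord_diagram (insert (x, y) D)"
    unfolding chord_diagram_def
  proof (intro conjI ballI impI)
    show "finite (insert (x, y) D)" using assms(1) by (simp add: chord_diagram_def)
    show "fst c < snd c" if "c \<in> insert (x, y) D" for c
      using that assms(1,4) by (auto simp: chord_diagram_def)
    fix c1 c2 assume c: "c1 \<in> insert (x, y) D" "c2 \<in> insert (x, y) D" "c1 \<noteq> c2"
    then consider "c1 = (x, y)" "c2 \<in> D" | "c1 \<in> D" "c2 = (x, y)" | "c1 \<in> D" "c2 \<in> D" by blast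
    then show "{fst c1, snd c1} \<inter> {fst c2, snd c2} = {}"
    proof cases
      case 1
      then show ?thesis using *[of c2] by simp
    next
      case 2
      then show ?thesis using *[of c1] by (simp add: Int_commute)
    next
      case 3
      then show ?thesis using assms(1) c(3) unfolding chord_diagram_def by blast
    qed
  qed
qed

lemma chord_diagram_insert_mkchord:
  assumes "chord_diagram D" "x \<notin> endpoints D" "y \<notin> endpoints D" "x \<noteq> y"
  shows "chord_diagram (insert (mkchord x y) D)" "mkchord x y \<notin> D"
proof -
  consider "x < y" "mkchord x y = (x, y)" | "y < x" "mkchord x y = (y, x)"
    using assms(4) by (cases "x < y") (simp_all add: mkchord_def)
  then show "chord_diagram (insert (mkchord x y) D)" "mkchord x y \<notin> D"
    using chord_diagram_insert[OF assms(1)] assms(2,3) by (cases; simp)+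
qed

lemma state_sum_insert_mkchord:
  assumes "chord_diagram D" "x \<notin> endpoints D" "y \<notin> endpoints D" "x \<noteq> y"
  shows "state_sum (insert (mkchord x y) D) F = state_sum D (peelu x y F)"
  using chord_diagram_insert_mkchord[OF assms] by (simp add: mkchord_def peelu_def state_sum_insert)

text \<open>The points \<open>z\<close> and \<open>w\<close> keep the letter H in every state and
  are extracted as the factor \<open>hh\<close>; the other two points form the new chord.\<close>

lemma hh_cw_mkchord:
  assumes cd: "chord_diagram D" and n: "{x, y, z, w} \<inter> endpoints D = {}" and d: "distinct [x, y, z, w]"
  shows "state_sum D (peelu x y (\<lambda>l. wd l ({x, y, z, w} \<union> endpoints D))) = hh * cw (insert (mkchord x y) D)"
proof -
  have "peelu x y (\<lambda>l. wd l ({x, y, z, w} \<union> endpoints D)) l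
      = hh * peelu x y (\<lambda>l. wd l (insert x (insert y (endpoints D)))) l" if "adm (endpoints D) l" for l
  proof -
    have z: "l x = 0" "l y = 0" "l z = 0" "l w = 0" and l4: "\<forall>s. l s < 4"
      using that n by (auto simp: adm_def)
    have "wd (l(x := i, y := j)) ({x, y, z, w} \<union> endpoints D)
       = hh * wd (l(x := i, y := j)) (insert x (insert y (endpoints D)))" if "i < 4" "j < 4" for i j
    proof -
      have "{x, y, z, w} \<union> endpoints D = insert z (insert w (insert x (insert y (endpoints D))))" by auto
      then show ?thesis
        using n d z l4 that finite_endpoints[OF cd] by (simp only:) (intro wd_zero2; auto)
    qed
    then show ?thesis
      using z d by (simp add: peelu_eq distrib_left right_diff_distrib) (simp add: cst_normalize)
  qed
  then have "state_sum D (peelu x y (\<lambda>l. wd l ({x, y, z, w} \<union> endpoints D)))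
    = hh * state_sum D (peelu x y (\<lambda>l. wd l (insert x (insert y (endpoints D)))))"
    unfolding state_sum_mult[symmetric] by (intro state_sum_cong[OF cd])
  then show ?thesis
    unfolding cw_def endpoints_insert_mkchord using n d by (subst state_sum_insert_mkchord[OF cd]) auto
qed

text \<open>Sum out both chords, apply \<open>four_point\<close>, and read each of the four
  resulting terms back as the state sum of a diagram with one new chord.\<close>

lemma pair_term:
  assumes cd: "chord_diagram D" and n: "{s, s', t, t'} \<inter> endpoints D = {}"
    and d: "distinct [s, s', t, t']" and st: "s < t"
  defines "D' \<equiv> insert (mkchord s s') (insert (mkchord t t') D)"
  shows "state_sum D' (ad_pair (\<lambda>l. wd l (endpoints D')) s t)
    = hh * (cw (insert (mkchord s t') D) + cw (insert (mkchord s' t) D)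
          - cw (insert (mkchord s t) D) - cw (insert (mkchord s' t') D))"
proof -
  define E where "E = {s, s', t, t'} \<union> endpoints D"
  have E: "endpoints D' = E" by (simp add: D'_def E_def endpoints_insert_mkchord)
  have cd1: "chord_diagram (insert (mkchord s s') D)"
    using chord_diagram_insert_mkchord[OF cd] n d by simp
  have "state_sum D' (ad_pair (\<lambda>l. wd l E) s t)
     = state_sum D (peelu s s' (peelu t t' (ad_pair (\<lambda>l. wd l E) s t)))"
    unfolding D'_def insert_commute[of "mkchord s s'"]
    using n d by (simp add: state_sum_insert_mkchord cd cd1 endpoints_insert_mkchord)
  also have "\<dots> = state_sum D (\<lambda>l. peelu s t' (\<lambda>l. wd l E) l + peelu s' t (\<lambda>l. wd l E) l
      - peelu s t (\<lambda>l. wd l E) l - peelu s' t' (\<lambda>l. wd l E) l)"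
  proof (rule state_sum_cong[OF cd])
    fix l assume "adm (endpoints D) l"
    then have "l s = 0" "l s' = 0" "l t = 0" "l t' = 0" using n by (auto simp: adm_def)
    then show "peelu s s' (peelu t t' (ad_pair (\<lambda>l. wd l E) s t)) l = peelu s t' (\<lambda>l. wd l E) l
      + peelu s' t (\<lambda>l. wd l E) l - peelu s t (\<lambda>l. wd l E) l - peelu s' t' (\<lambda>l. wd l E) l"
      using d st by (intro four_point) auto
  qed
  also have "\<dots> = hh * (cw (insert (mkchord s t') D) + cw (insert (mkchord s' t) D)
          - cw (insert (mkchord s t) D) - cw (insert (mkchord s' t') D))"
  proof -
    have "E = {s, t', s', t} \<union> endpoints D" "E = {s', t, s, t'} \<union> endpoints D"
      "E = {s, t, s', t'} \<union> endpoints D" "E = {s', t', s, t} \<union> endpoints D" by (auto simp: E_def)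
    moreover have "state_sum D (peelu s t' (\<lambda>l. wd l ({s, t', s', t} \<union> endpoints D))) = hh * cw (insert (mkchord s t') D)"
      "state_sum D (peelu s' t (\<lambda>l. wd l ({s', t, s, t'} \<union> endpoints D))) = hh * cw (insert (mkchord s' t) D)"
      "state_sum D (peelu s t (\<lambda>l. wd l ({s, t, s', t'} \<union> endpoints D))) = hh * cw (insert (mkchord s t) D)"
      "state_sum D (peelu s' t' (\<lambda>l. wd l ({s', t', s, t} \<union> endpoints D))) = hh * cw (insert (mkchord s' t') D)"
      using n d by (intro hh_cw_mkchord[OF cd]; auto)+
    ultimately show ?thesis
      by (simp only: state_sum_diff state_sum_add distrib_left right_diff_distrib)
  qed
  finally show ?thesis unfolding E .
qed

section \<open>Regrouping sums over endpoints as sums over chords\<close>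

lemma chord_endpoints_disjoint:
  "chord_diagram D \<Longrightarrow> b \<in> D \<Longrightarrow> c \<in> D \<Longrightarrow> b \<noteq> c \<Longrightarrow> {fst b, snd b} \<inter> {fst c, snd c} = {}"
  by (simp add: chord_diagram_def)

lemma sum_over_chords:
  fixes f :: "nat \<Rightarrow> 'a :: comm_monoid_add"
  assumes cd: "chord_diagram D" and L: "L \<subseteq> endpoints D"
  shows "(\<Sum>s\<in>L. f s) = (\<Sum>b\<in>D. \<Sum>s\<in>L \<inter> {fst b, snd b}. f s)"
proof -
  have "L = (\<Union>b\<in>D. L \<inter> {fst b, snd b})" using L by (auto simp: endpoints_def)
  moreover have "(\<Sum>s\<in>(\<Union>b\<in>D. L \<inter> {fst b, snd b}). f s) = (\<Sum>b\<in>D. \<Sum>s\<in>L \<inter> {fst b, snd b}. f s)"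
  proof (rule sum.UNION_disjoint)
    show "finite D" using cd by (simp add: chord_diagram_def)
    show "\<forall>b\<in>D. \<forall>c\<in>D. b \<noteq> c \<longrightarrow> L \<inter> {fst b, snd b} \<inter> (L \<inter> {fst c, snd c}) = {}"
      using chord_endpoints_disjoint[OF cd] by blast
  qed simp
  ultimately show ?thesis by simp
qed

text \<open>Pair terms are ordered by the positions of the letters, the recursion orders chords by
  first endpoint. Grouping (b, c) with (c, b) reconciles the two orders.\<close>

lemma sum_unordered_pairs:
  fixes key :: "'b \<Rightarrow> nat" and \<phi> :: "'b \<Rightarrow> 'b \<Rightarrow> 'a :: comm_monoid_add"
  assumes "finite A" "inj_on key A"
  shows "(\<Sum>b\<in>A. \<Sum>c\<in>A. \<phi> b c)
    = (\<Sum>b\<in>A. \<phi> b b) + (\<Sum>(b, c)\<in>{(b, c). b \<in> A \<and> c \<in> A \<and> key b < key c}. \<phi> b c + \<phi> c b)"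
proof -
  define P where "P = {(b, c). b \<in> A \<and> c \<in> A \<and> key b < key c}"
  define dg where "dg = (\<lambda>b. (b, b)) ` A"
  have fP: "finite P" by (rule finite_subset[of _ "A \<times> A"]) (use assms(1) in \<open>auto simp: P_def\<close>)
  have "x \<in> A \<times> A \<longleftrightarrow> x \<in> dg \<union> (P \<union> prod.swap ` P)" for x
  proof (cases x)
    case (Pair b c)
    have "key b < key c \<or> key c < key b \<or> b = c" if "b \<in> A" "c \<in> A"
      using assms(2) that by (metis inj_onD linorder_neqE_nat)
    then show ?thesis by (auto simp: Pair P_def dg_def image_iff)
  qed
  then have "A \<times> A = dg \<union> (P \<union> prod.swap ` P)" by blast
  then have "(\<Sum>b\<in>A. \<Sum>c\<in>A. \<phi> b c) = (\<Sum>x\<in>dg \<union> (P \<union> prod.swap ` P). case x of (b, c) \<Rightarrow> \<phi> b c)"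
    by (simp add: sum.cartesian_product)
  also have "\<dots> = (\<Sum>x\<in>dg. case x of (b, c) \<Rightarrow> \<phi> b c)
      + (\<Sum>x\<in>P \<union> prod.swap ` P. case x of (b, c) \<Rightarrow> \<phi> b c)"
    using assms(1) fP by (intro sum.union_disjoint) (auto simp: dg_def P_def)
  also have "(\<Sum>x\<in>P \<union> prod.swap ` P. case x of (b, c) \<Rightarrow> \<phi> b c)
     = (\<Sum>x\<in>P. case x of (b, c) \<Rightarrow> \<phi> b c) + (\<Sum>x\<in>prod.swap ` P. case x of (b, c) \<Rightarrow> \<phi> b c)"
    using fP by (intro sum.union_disjoint) (auto simp: P_def)
  also have "(\<Sum>x\<in>prod.swap ` P. case x of (b, c) \<Rightarrow> \<phi> b c) = (\<Sum>(b, c)\<in>P. \<phi> c b)"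
    by (subst sum.reindex) (auto simp: case_prod_unfold intro!: sum.cong)
  also have "(\<Sum>x\<in>dg. case x of (b, c) \<Rightarrow> \<phi> b c) = (\<Sum>b\<in>A. \<phi> b b)"
    unfolding dg_def by (subst sum.reindex) (auto simp: inj_on_def)
  finally show ?thesis
    unfolding P_def[symmetric] by (simp add: sum.distrib case_prod_unfold)
qed

lemma chord_endpoint_removed:
  assumes "chord_diagram D" "b \<in> D" "b \<in> C" "x \<in> {fst b, snd b}"
  shows "x \<notin> endpoints (D - C)"
proof
  assume "x \<in> endpoints (D - C)"
  then obtain ch where "ch \<in> D - C" "x = fst ch \<or> x = snd ch" by (elim endpointsE)
  then show False using assms(2-) chord_endpoints_disjoint[OF assms(1), of b ch] by auto
qed

lemma cw_recursion:
  assumes cd: "chord_diagram (insert a D)" and new: "a \<notin> D"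
  shows "cw (insert a D) = cas * cw D + hh * (\<Sum>b\<in>{b\<in>D. crosses a b}. cw (D - {b}))
    - hh * (\<Sum>(b, b')\<in>{(b, b'). b \<in> D \<and> b' \<in> D \<and> crosses a b \<and> crosses a b' \<and> fst b < fst b'}.
        cw (insert (mkchord (lend a b) (rend a b')) (D - {b, b'}))
      + cw (insert (mkchord (rend a b) (lend a b')) (D - {b, b'}))
      - cw (insert (mkchord (lend a b) (lend a b')) (D - {b, b'}))
      - cw (insert (mkchord (rend a b) (rend a b')) (D - {b, b'})))"
proof -
  obtain p q where a: "a = (p, q)" by fastforce
  have cdD: "chord_diagram D" using cd by (rule chord_diagram_subset) auto
  have finD: "finite D" using cdD by (simp add: chord_diagram_def)
  note fresh = fresh_endpoints[OF cd[unfolded a] new[unfolded a]]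
  define E where "E = endpoints D"
  define L where "L = {s\<in>E. p < s \<and> s < q}"
  define inL where "inL s \<longleftrightarrow> p < s \<and> s < q" for s
  define e where "e b = L \<inter> {fst b, snd b}" for b
  define opp where "opp b s = (if s = fst b then snd b else fst b)" for b :: "nat \<times> nat" and s
  have finL: "finite L" using finite_endpoints[OF cdD] by (simp add: L_def E_def)
  have LE: "L \<subseteq> endpoints D" by (auto simp: L_def E_def)
  have lt: "fst b < snd b" if "b \<in> D" for b using cdD that by (auto simp: chord_diagram_def)
  note disj = chord_endpoints_disjoint[OF cdD]
  have inj: "inj_on fst D"
  proof (rule inj_onI, rule ccontr)
    fix b c assume "b \<in> D" "c \<in> D" "fst b = fst c" "b \<noteq> c"
    then show False using disj[of b c] by simp
  qed
  have e: "e b = (if inL (fst b) then {fst b} else {}) \<union> (if inL (snd b) then {snd b} else {})" if "b \<in> D" for b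
    using that by (auto simp: e_def L_def inL_def E_def endpoints_def)
  have cr: "crosses a b \<longleftrightarrow> inL (fst b) \<noteq> inL (snd b)" if "b \<in> D" for b
    using that new by (auto simp: crosses_def inL_def a)
  have ends: "lend a b = (if inL (fst b) then fst b else snd b)"
    "rend a b = (if inL (fst b) then snd b else fst b)" for b
    by (simp_all add: lend_def rend_def inL_def a)
  note not_endpoint = chord_endpoint_removed[OF cdD]

  have single: "state_sum D (\<lambda>l. if l s = 1 then wd (l(s := 0)) E else 0) = hh * cw (D - {b})"
    if "b \<in> D" "s \<in> e b" for s b
  proof -
    have D: "insert (fst b, snd b) (D - {b}) = D" using that by auto
    show ?thesis
      using single_term[of "fst b" "snd b" "D - {b}" s] that cdD by (simp only: D E_def) (auto simp: e_def)
  qed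
  have same: "state_sum D (ad_pair (\<lambda>l. wd l E) (fst b) (snd b)) = hh * cw (D - {b}) + hh * cw (D - {b})"
    if "b \<in> D" for b
  proof -
    have D: "insert (fst b, snd b) (D - {b}) = D" using that by auto
    show ?thesis
      using same_chord_term[of "fst b" "snd b" "D - {b}"] that cdD by (simp only: D E_def) auto
  qed

  define N where "N b c x y = cw (insert (mkchord x y) (D - {b, c}))" for b c x y
  define V where "V b c s t = hh * (N b c s (opp c t) + N b c (opp b s) t - N b c s t - N b c (opp b s) (opp c t))"
    for b c s t
  \<comment> \<open>The value does not depend on which of the two points comes first;
    \<open>pair\<close> treats only the order \<open>s < t\<close>.\<close>
  have V_commute: "V c b t s = V b c s t" for b c s t
    by (simp add: V_def N_def mkchord_commute insert_commute add.commute diff_diff_eq)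
  have pair: "state_sum D (ad_pair (\<lambda>l. wd l E) s t) = V b c s t"
    if "b \<in> D" "c \<in> D" "b \<noteq> c" "s \<in> {fst b, snd b}" "t \<in> {fst c, snd c}" "s < t" for b c s t
  proof -
    have "mkchord s (opp b s) = b" "mkchord t (opp c t) = c"
      using that lt[of b] lt[of c] by (auto simp: mkchord_def opp_def)
    then have D: "insert (mkchord s (opp b s)) (insert (mkchord t (opp c t)) (D - {b, c})) = D"
      using that by auto
    have n: "{s, opp b s, t, opp c t} \<inter> endpoints (D - {b, c}) = {}"
      using that not_endpoint[of b "{b, c}"] not_endpoint[of c "{b, c}"] by (simp add: opp_def)
    have d: "distinct [s, opp b s, t, opp c t]"
      using that disj[of b c] lt[of b] lt[of c] by (auto simp: opp_def)
    show ?thesis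
      using pair_term[OF chord_diagram_subset[OF cdD Diff_subset] n d that(6)]
      by (simp only: D V_def N_def E_def)
  qed

  \<comment> \<open>Extension by 0 turns the triangular sum into a square one, which splits into one
    block per ordered pair of chords.\<close>
  define r where "r s t = (if s < t then state_sum D (ad_pair (\<lambda>l. wd l E) s t) else 0)" for s t
  define \<phi> where "\<phi> b c = (\<Sum>s\<in>e b. \<Sum>t\<in>e c. r s t)" for b c
  have \<phi>_diag: "\<phi> b b = (if inL (fst b) \<and> inL (snd b) then hh * cw (D - {b}) + hh * cw (D - {b}) else 0)"
    if "b \<in> D" for b
    using lt[OF that] same[OF that] by (auto simp: \<phi>_def e[OF that] r_def)
  have \<phi>_off: "\<phi> b c + \<phi> c b = (if crosses a b \<and> crosses a c then V b c (lend a b) (lend a c) else 0)"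
    if bc: "b \<in> D" "c \<in> D" "b \<noteq> c" for b c
  proof -
    have "\<phi> c b = (\<Sum>s\<in>e b. \<Sum>t\<in>e c. r t s)" unfolding \<phi>_def by (rule sum.swap)
    then have "\<phi> b c + \<phi> c b = (\<Sum>s\<in>e b. \<Sum>t\<in>e c. r s t + r t s)"
      by (simp add: \<phi>_def sum.distrib)
    also have "\<dots> = (\<Sum>s\<in>e b. \<Sum>t\<in>e c. V b c s t)"
    proof (intro sum.cong refl)
      fix s t assume "s \<in> e b" "t \<in> e c"
      then have st: "s \<in> {fst b, snd b}" "t \<in> {fst c, snd c}" by (auto simp: e_def)
      then have "s \<noteq> t" using disj[OF bc] by auto
      then consider "s < t" | "t < s" by linarith
      then show "r s t + r t s = V b c s t"
        using pair[OF bc st] pair[OF bc(2,1) bc(3)[symmetric] st(2,1)] V_commute by cases (simp_all add: r_def)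
    qed
    \<comment> \<open>\<open>V\<close> changes sign when \<open>s\<close> is replaced by the other
      end of \<open>b\<close>, or \<open>t\<close> by the other end of \<open>c\<close>. A chord
      with both ends on the left arc therefore contributes 0, and one with no end there gives an
      empty sum.\<close>
    also have "\<dots> = (if crosses a b \<and> crosses a c then V b c (lend a b) (lend a c) else 0)"
      using lt[OF bc(1)] lt[OF bc(2)]
      by (simp add: e[OF bc(1)] e[OF bc(2)] cr[OF bc(1)] cr[OF bc(2)] ends)
        (auto simp: V_def opp_def algebra_simps)
    finally show ?thesis .
  qed

  have "cw (insert a D) = cas * cw D
     + (\<Sum>s\<in>L. state_sum D (\<lambda>l. if l s = 1 then wd (l(s := 0)) E else 0))
     - (\<Sum>s\<in>L. \<Sum>t\<in>{t\<in>L. s < t}. state_sum D (ad_pair (\<lambda>l. wd l E) s t))"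
    unfolding a L_def E_def by (rule chord_expansion) (use cd new a in auto)
  also have "(\<Sum>s\<in>L. state_sum D (\<lambda>l. if l s = 1 then wd (l(s := 0)) E else 0))
     = (\<Sum>b\<in>D. \<Sum>s\<in>e b. hh * cw (D - {b}))"
    unfolding sum_over_chords[OF cdD LE] e_def[symmetric] by (intro sum.cong refl single)
  also have "(\<Sum>s\<in>L. \<Sum>t\<in>{t\<in>L. s < t}. state_sum D (ad_pair (\<lambda>l. wd l E) s t)) = (\<Sum>s\<in>L. \<Sum>t\<in>L. r s t)"
    unfolding r_def using finL by (simp add: sum.inter_filter)
  also have "\<dots> = (\<Sum>b\<in>D. \<Sum>c\<in>D. \<phi> b c)"
    unfolding sum_over_chords[OF cdD LE] e_def[symmetric] \<phi>_def
    by (intro sum.cong refl) (rule sum.swap)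
  also have "\<dots> = (\<Sum>b\<in>D. \<phi> b b) + (\<Sum>(b, c)\<in>{(b, c). b \<in> D \<and> c \<in> D \<and> fst b < fst c}. \<phi> b c + \<phi> c b)"
    using finD inj by (rule sum_unordered_pairs)
  also have "(\<Sum>(b, c)\<in>{(b, c). b \<in> D \<and> c \<in> D \<and> fst b < fst c}. \<phi> b c + \<phi> c b)
     = (\<Sum>(b, c)\<in>{(b, c). b \<in> D \<and> c \<in> D \<and> fst b < fst c}.
          if crosses a b \<and> crosses a c then V b c (lend a b) (lend a c) else 0)"
    by (intro sum.cong refl) (use \<phi>_off in fastforce)
  also have "\<dots> = (\<Sum>(b, c)\<in>{(b, c). b \<in> D \<and> c \<in> D \<and> crosses a b \<and> crosses a c \<and> fst b < fst c}.
          V b c (lend a b) (lend a c))"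
    by (rule sum.mono_neutral_cong_right)
      (auto intro: finite_subset[of _ "D \<times> D"] simp: finD split: if_splits)
  also have "\<dots> = hh * (\<Sum>(b, c)\<in>{(b, c). b \<in> D \<and> c \<in> D \<and> crosses a b \<and> crosses a c \<and> fst b < fst c}.
          N b c (lend a b) (rend a c) + N b c (rend a b) (lend a c)
        - N b c (lend a b) (lend a c) - N b c (rend a b) (rend a c))"
    unfolding sum_distrib_left using lt
    by (intro sum.cong refl) (auto simp: V_def opp_def ends dest!: lt)
  finally have *: "cw (insert a D) = cas * cw D
     + ((\<Sum>b\<in>D. \<Sum>s\<in>e b. hh * cw (D - {b})) - (\<Sum>b\<in>D. \<phi> b b))
     - hh * (\<Sum>(b, c)\<in>{(b, c). b \<in> D \<and> c \<in> D \<and> crosses a b \<and> crosses a c \<and> fst b < fst c}.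
          N b c (lend a b) (rend a c) + N b c (rend a b) (lend a c)
        - N b c (lend a b) (lend a c) - N b c (rend a b) (rend a c))"
    by (simp add: algebra_simps)
  have "(\<Sum>b\<in>D. \<Sum>s\<in>e b. hh * cw (D - {b})) - (\<Sum>b\<in>D. \<phi> b b)
     = (\<Sum>b\<in>D. if crosses a b then hh * cw (D - {b}) else 0)"
    unfolding sum_subtractf[symmetric]
  proof (intro sum.cong refl)
    fix b assume b: "b \<in> D"
    \<comment> \<open>Each end on the left arc gives one single term. With both ends there, the two
      single terms cancel against the diagonal block; with exactly one end there, the diagonal block
      is 0 and one term remains.\<close>
    show "(\<Sum>s\<in>e b. hh * cw (D - {b})) - \<phi> b b = (if crosses a b then hh * cw (D - {b}) else 0)"
      using lt[OF b] by (auto simp: \<phi>_diag[OF b] e[OF b] cr[OF b] mult_2)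
  qed
  also have "\<dots> = hh * (\<Sum>b\<in>{b\<in>D. crosses a b}. cw (D - {b}))"
    unfolding sum_distrib_left using finD by (simp add: sum.inter_filter)
  finally show ?thesis using * unfolding N_def by simp
qed

section \<open>Return from the quotient ring to coefficient functions\<close>

lemma abs_casimir: "abs_ugl casimir = cas" "fsupp casimir"
proof -
  have *: "casimir = (\<lambda>w. \<Sum>i\<in>{0,1,2,3}. \<Sum>j\<in>{0,1,2,3}. smul (casC i j) (ncmul (gen i) (gen j)) w)"
  proof -
    have "{..<4} = {0, 1, 2, 3 :: nat}" by auto
    then show ?thesis by (simp only: casimir_def smul_def)
  qed
  show "fsupp casimir" unfolding * by (intro fsupp_sum) (simp add: gen_def)
  have "abs_ugl casimir = (\<Sum>i\<in>{0,1,2,3}. \<Sum>j\<in>{0,1,2,3}. cst (casC i j) * (gn i * gn j))"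
    unfolding *
    by (subst abs_ugl_sum, simp add: gen_def fsupp_sum)
      (intro sum.cong refl, subst abs_ugl_sum,
       simp_all only: gen_def abs_ugl_smul abs_ugl_ncmul abs_ugl_monom fsupp_smul fsupp_ncmul fsupp_monom)
  then show "abs_ugl casimir = cas" by (simp add: casC_def cas_def)
qed

lemma abs_y_el: "abs_ugl y_el = - hh" "fsupp y_el"
  by (simp_all add: y_el_def h_el_def gen_def abs_ugl_uminus abs_ugl_ncmul abs_ugl_monom)

lemma abs_Wt_cw: "chord_diagram D \<Longrightarrow> abs_ugl (Wt D) = cw D"
  by (simp add: abs_Wt cw_def)

theorem mainTheorem1:
  assumes "chord_diagram D" and "a \<in> D"
  shows "ueq (Wt D)
    (\<lambda>w. ncmul casimir (Wt (D - {a})) w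
        - ncmul y_el (\<lambda>v. \<Sum>b\<in>{b\<in>D. crosses a b}. Wt (D - {a, b}) v) w
        + ncmul y_el (\<lambda>v. \<Sum>(b, b')\<in>{(b, b'). b \<in> D \<and> b' \<in> D \<and> crosses a b \<and> crosses a b' \<and> fst b < fst b'}.
             Wt (insert (mkchord (lend a b) (rend a b')) (D - {a, b, b'})) v
           + Wt (insert (mkchord (rend a b) (lend a b')) (D - {a, b, b'})) v
           - Wt (insert (mkchord (lend a b) (lend a b')) (D - {a, b, b'})) v
           - Wt (insert (mkchord (rend a b) (rend a b')) (D - {a, b, b'})) v) w)"
proof -
  let ?D = "D - {a}"
  define X where "X = {b\<in>D. crosses a b}"
  define P where "P = {(b, b'). b \<in> D \<and> b' \<in> D \<and> crosses a b \<and> crosses a b' \<and> fst b < fst b'}"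
  define C where "C x b c = insert x (D - {a, b, c})" for x b c :: "nat \<times> nat"
  define T where "T b c v = Wt (C (mkchord (lend a b) (rend a c)) b c) v
           + Wt (C (mkchord (rend a b) (lend a c)) b c) v
           - Wt (C (mkchord (lend a b) (lend a c)) b c) v
           - Wt (C (mkchord (rend a b) (rend a c)) b c) v" for b c v
  have D: "insert a ?D = D" using assms(2) by auto
  have not_self: "\<not> crosses a a" by (simp add: crosses_def)
  \<comment> \<open>A chord does not cross itself, so the index sets are the same for
    \<open>D\<close> and for \<open>D - {a}\<close>, the diagram to which
    \<open>cw_recursion\<close> refers.\<close>
  have X: "X = {b \<in> ?D. crosses a b}"
    and P: "P = {(b, b'). b \<in> ?D \<and> b' \<in> ?D \<and> crosses a b \<and> crosses a b' \<and> fst b < fst b'}"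
    unfolding X_def P_def using not_self by auto
  have cd_sub: "chord_diagram (D - S)" for S by (rule chord_diagram_subset[OF assms(1)]) auto
  have fT: "fsupp (T b c)" for b c
    unfolding T_def by (intro fsupp_diff fsupp_add fsupp_Wt)
  have aT: "abs_ugl (T b c) = cw (C (mkchord (lend a b) (rend a c)) b c)
           + cw (C (mkchord (rend a b) (lend a c)) b c)
           - cw (C (mkchord (lend a b) (lend a c)) b c)
           - cw (C (mkchord (rend a b) (rend a c)) b c)" if "(b, c) \<in> P" for b c
  proof -
    have bc: "b \<in> D" "c \<in> D" "b \<noteq> c" using that by (auto simp: P_def)
    have ne: "x \<noteq> y" if "x \<in> {fst b, snd b}" "y \<in> {fst c, snd c}" for x y
      using chord_endpoints_disjoint[OF assms(1) bc] that by auto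
    \<comment> \<open>Once \<open>b\<close> and \<open>c\<close> are removed their ends are free,
      and an end of \<open>b\<close> differs from any end of \<open>c\<close>; so each new chord
      yields a diagram, as \<open>abs_Wt_cw\<close> requires.\<close>
    have "chord_diagram (C (mkchord x y) b c)" if "x \<in> {fst b, snd b}" "y \<in> {fst c, snd c}" for x y
      unfolding C_def using that bc ne[OF that] chord_endpoint_removed[OF assms(1)]
      by (intro chord_diagram_insert_mkchord cd_sub) auto
    then show ?thesis
      unfolding T_def by (simp add: abs_ugl_diff abs_ugl_add fsupp_Wt abs_Wt_cw lend_def rend_def)
  qed
  have fX: "fsupp (\<lambda>v. \<Sum>b\<in>X. Wt (D - {a, b}) v)" by (intro fsupp_sum fsupp_Wt)
  have fP: "fsupp (\<lambda>v. \<Sum>(b, c)\<in>P. T b c v)"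
    unfolding case_prod_unfold by (intro fsupp_sum fT)
  have aX: "abs_ugl (\<lambda>v. \<Sum>b\<in>X. Wt (D - {a, b}) v) = (\<Sum>b\<in>X. cw (D - {a, b}))"
    by (subst abs_ugl_sum) (simp_all add: fsupp_Wt abs_Wt_cw cd_sub)
  have aP: "abs_ugl (\<lambda>v. \<Sum>(b, c)\<in>P. T b c v) = (\<Sum>(b, c)\<in>P. abs_ugl (T b c))"
    unfolding case_prod_unfold by (subst abs_ugl_sum) (simp_all add: fT)
  have minus2: "D - {a} - {b} = D - {a, b}" "D - {a} - {b, c} = D - {a, b, c}" for b c by auto
  have "ueq (Wt D) (\<lambda>w. ncmul casimir (Wt ?D) w - ncmul y_el (\<lambda>v. \<Sum>b\<in>X. Wt (D - {a, b}) v) w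
      + ncmul y_el (\<lambda>v. \<Sum>(b, c)\<in>P. T b c v) w)"
  proof (subst ueq_iff_abs)
    show "fsupp (Wt D)" by (rule fsupp_Wt)
    show "fsupp (\<lambda>w. ncmul casimir (Wt ?D) w - ncmul y_el (\<lambda>v. \<Sum>b\<in>X. Wt (D - {a, b}) v) w
      + ncmul y_el (\<lambda>v. \<Sum>(b, c)\<in>P. T b c v) w)"
      by (intro fsupp_add fsupp_diff fsupp_ncmul fsupp_Wt fX fP abs_casimir abs_y_el)
    have "abs_ugl (\<lambda>w. ncmul casimir (Wt ?D) w - ncmul y_el (\<lambda>v. \<Sum>b\<in>X. Wt (D - {a, b}) v) w
      + ncmul y_el (\<lambda>v. \<Sum>(b, c)\<in>P. T b c v) w)
      = cas * cw ?D - (- hh) * (\<Sum>b\<in>X. cw (D - {a, b})) + (- hh) * (\<Sum>(b, c)\<in>P. abs_ugl (T b c))"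
      by (simp only: abs_ugl_add abs_ugl_diff abs_ugl_ncmul fsupp_diff fsupp_ncmul fsupp_Wt fX fP
          abs_casimir abs_y_el aX aP abs_Wt_cw cd_sub)
    also have "(\<Sum>(b, c)\<in>P. abs_ugl (T b c)) = (\<Sum>(b, c)\<in>P. cw (C (mkchord (lend a b) (rend a c)) b c)
           + cw (C (mkchord (rend a b) (lend a c)) b c)
           - cw (C (mkchord (lend a b) (lend a c)) b c)
           - cw (C (mkchord (rend a b) (rend a c)) b c))"
      by (intro sum.cong refl) (auto simp: aT)
    also have "cas * cw ?D - (- hh) * (\<Sum>b\<in>X. cw (D - {a, b})) + (- hh) * \<dots> = cw D"
      using cw_recursion[of a ?D, unfolded D X[symmetric] P[symmetric] minus2, OF assms(1)]
      by (simp add: C_def)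
    finally show "abs_ugl (Wt D) = abs_ugl (\<lambda>w. ncmul casimir (Wt ?D) w
      - ncmul y_el (\<lambda>v. \<Sum>b\<in>X. Wt (D - {a, b}) v) w + ncmul y_el (\<lambda>v. \<Sum>(b, c)\<in>P. T b c v) w)"
      using abs_Wt_cw[OF assms(1)] by simp
  qed
  then show ?thesis unfolding X_def P_def T_def C_def .
qed

end
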